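(* Let $\mathcal{C}_{\le n}$ be the family of all cycles of length at most $n$ and let $P_n$ be the path on $n$ vertices. With probability tending to $1$ as $n\to\infty$, a uniformly random $31$-regular simple graph $G \in \mathcal{G}_{2n,31}$ on $2n$ labelled vertices satisfies $G \to (\mathcal{C}_{\le n}, P_n)$. Consequently, $\hat{R}(\mathcal{C}_{\le n},P_n) \le 31 n$ for all sufficiently large $n$.
   Context: All graphs are finite and simple. For a family of graphs $\mathcal{F}$ and a graph $H$, write $G\to(\mathcal{F},H)$ if every colouring of the edges of $G$ with two colours, red and blue, yields a red copy (as a not necessarily induced subgraph) of some graph from $\mathcal{F}$ or a blue copy of $H$. The size-Ramsey number is $\hat{R}(\mathcal{F},H)=\min\{|E(G)| : G\to(\mathcal{F},H)\}$. $\mathcal{G}_{N,d}$ denotes the uniform probability space of simple $d$-regular graphs on $N$ labelled vertices. *)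

theory Defs
  imports "HOL-Probability.Probability" "HOL-Library.Extended_Nat"
begin

record 'a graph =
  verts :: "'a set"
  edges :: "'a set set"

definition simple_graph :: "'a graph \<Rightarrow> bool" where
  "simple_graph G \<longleftrightarrow> finite (verts G) \<and> edges G \<subseteq> {e. e \<subseteq> verts G \<and> card e = 2}"

definition degree :: "'a graph \<Rightarrow> 'a \<Rightarrow> nat" where
  "degree G v = card {e \<in> edges G. v \<in> e}"

definition regular :: "nat \<Rightarrow> 'a graph \<Rightarrow> bool" where
  "regular d G \<longleftrightarrow> (\<forall>v \<in> verts G. degree G v = d)"

text \<open>\<open>H\<close> occurs in \<open>G\<close> as a not necessarily induced subgraph, up to isomorphism.\<close>

definition contains_copy :: "'a graph \<Rightarrow> 'b graph \<Rightarrow> bool" where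
  "contains_copy G H \<longleftrightarrow>
     (\<exists>f. inj_on f (verts H) \<and> f ` verts H \<subseteq> verts G \<and> (\<forall>e \<in> edges H. f ` e \<in> edges G))"

datatype colour = Red | Blue

definition colour_class :: "'a graph \<Rightarrow> ('a set \<Rightarrow> colour) \<Rightarrow> colour \<Rightarrow> 'a graph" where
  "colour_class G c k = \<lparr>verts = verts G, edges = {e \<in> edges G. c e = k}\<rparr>"

definition arrows :: "'a graph \<Rightarrow> 'b graph set \<Rightarrow> 'c graph \<Rightarrow> bool" where
  "arrows G \<F> H \<longleftrightarrow>
     (\<forall>c. (\<exists>F \<in> \<F>. contains_copy (colour_class G c Red) F) \<or>
          contains_copy (colour_class G c Blue) H)"

text \<open>
  Every finite graph is isomorphic to one with vertices in \<^typ>\<open>nat\<close>, so it suffices to range over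
  such graphs.  The infimum in \<^typ>\<open>enat\<close> is the minimum if some graph arrows, and \<open>\<infinity>\<close> otherwise.
\<close>

definition size_ramsey :: "'b graph set \<Rightarrow> 'c graph \<Rightarrow> enat" where
  "size_ramsey \<F> H =
     Inf {enat (card (edges G)) | G :: nat graph. simple_graph G \<and> arrows G \<F> H}"

text \<open>The length of a cycle is its number of edges; a simple cycle has length at least 3.\<close>

definition cycle_graph :: "nat \<Rightarrow> nat graph" where
  "cycle_graph k = \<lparr>verts = {..<k}, edges = {{i, Suc i mod k} | i. i < k}\<rparr>"

definition cycles_upto :: "nat \<Rightarrow> nat graph set" where
  "cycles_upto n = {cycle_graph k | k. 3 \<le> k \<and> k \<le> n}"

definition path_graph :: "nat \<Rightarrow> nat graph" where
  "path_graph n = \<lparr>verts = {..<n}, edges = {{i, Suc i} | i. Suc i < n}\<rparr>"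

definition regular_graphs :: "nat \<Rightarrow> nat \<Rightarrow> nat graph set" where
  "regular_graphs N d = {G. simple_graph G \<and> verts G = {..<N} \<and> regular d G}"

text \<open>Meaningful only if a \<open>d\<close>-regular graph on \<open>N\<close> vertices exists (\<open>d < N\<close> and \<open>d * N\<close> even).\<close>

definition random_regular_graph :: "nat \<Rightarrow> nat \<Rightarrow> nat graph pmf" where
  "random_regular_graph N d = pmf_of_set (regular_graphs N d)"

lemma finite_regular_graphs: "finite (regular_graphs N d)"
proof (rule finite_subset)
  show "regular_graphs N d \<subseteq> (\<lambda>E. \<lparr>verts = {..<N}, edges = E\<rparr>) ` Pow (Pow {..<N})"
  proof
    fix G assume G: "G \<in> regular_graphs N d"
    then have "edges G \<in> Pow (Pow {..<N})"
      by (auto simp: regular_graphs_def simple_graph_def)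
    moreover have "G = \<lparr>verts = {..<N}, edges = edges G\<rparr>"
      using G by (simp add: regular_graphs_def)
    ultimately show "G \<in> (\<lambda>E. \<lparr>verts = {..<N}, edges = E\<rparr>) ` Pow (Pow {..<N})"
      by blast
  qed
qed simp

lemma simple_graph_path_graph: "simple_graph (path_graph n)"
  by (auto simp: simple_graph_def path_graph_def)

lemma simple_graph_cycle_graph:
  assumes "3 \<le> k"
  shows "simple_graph (cycle_graph k)"
proof -
  have "i \<noteq> Suc i mod k" if "i < k" for i
    using assms that by (cases "Suc i = k") auto
  then show ?thesis
    using assms by (auto simp: simple_graph_def cycle_graph_def card_insert_if)
qed

end

(*
  A two-colouring without a blue path on n vertices leaves, by a depth-first search, two disjoint sets
  S and T of floor (n/2) vertices each with no blue edge between them. If moreover there is no red cycle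
  of length at most n, then the S-T edges form a forest, so there are fewer than n of them. It remains to
  bound, for random regular graphs, the probability that some pair S, T spans so few edges.

  Number of d-regular graphs with few S-T edges: order and orient the edges. The resulting vertex
  sequence uses each vertex d times, so it suffices to count the sequences of classes S, T, rest,
  which is done by exponential weights a (vertices of S and T) and y (S-T edges).

  Total number of d-regular graphs: it is, up to a polynomial factor, the number of all pairings of the
  configuration model. Adding edges greedily costs only a polynomial factor until a bounded number of
  half-edges is left, and a switching completes the graph at polynomial cost per edge.

  Since polynomial factors are harmless, the union bound over S and T reduces to
  64 Q^62 < 64^31 a^62 y^2 with Q = 2 a^2 (1 + y) + 4 a + 1.
*)
theory Submission
  imports Defs "HOL-Combinatorics.Multiset_Permutations"
begin

section \<open>Sparse pairs from colourings\<close>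

text \<open>Depth-first search: \<open>S\<close> holds the finished vertices, \<open>p\<close> is
  the current path with its active end at the head, and no \<open>R\<close>-edge leads from
  \<open>S\<close> to an unvisited vertex. Instead of running the search, a state is chosen that
  maximises its progress.\<close>

lemma long_path_or_separated_sets:
  fixes R :: "'a \<Rightarrow> 'a \<Rightarrow> bool"
  assumes fin: "finite V" and sym: "\<And>x y. R x y \<Longrightarrow> R y x"
    and no_path: "\<And>p. distinct p \<Longrightarrow> set p \<subseteq> V \<Longrightarrow> successively R p \<Longrightarrow> length p < n"
    and size: "2 * h + n \<le> card V + 1"
  obtains S T where "S \<subseteq> V" "T \<subseteq> V" "S \<inter> T = {}" "card S = h" "card T = h"
    "\<And>s t. s \<in> S \<Longrightarrow> t \<in> T \<Longrightarrow> \<not> R s t"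
proof -
  define state where "state = (\<lambda>(S, p). S \<subseteq> V \<and> set p \<subseteq> V \<and> S \<inter> set p = {} \<and> distinct p \<and>
     successively R p \<and> card S \<le> h \<and> (\<forall>s\<in>S. \<forall>t\<in>V - S - set p. \<not> R s t))"
  \<comment> \<open>Each move raises this measure by exactly one: pushing a vertex lengthens
    \<open>p\<close>, while retiring the head shortens \<open>p\<close> by one and enlarges
    \<open>S\<close> by one.\<close>
  define \<mu> where "\<mu> = (\<lambda>(S :: 'a set, p :: 'a list). 2 * card S + length p)"
  have "state ({}, [])" by (simp add: state_def)
  moreover have "\<forall>z. state z \<longrightarrow> \<mu> z < 2 * h + n"
  proof (intro allI impI)
    fix z assume "state z"
    then show "\<mu> z < 2 * h + n"
      using no_path[of "snd z"] by (cases z) (simp add: state_def \<mu>_def)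
  qed
  ultimately have "\<exists>z. state z \<and> (\<forall>z'. state z' \<longrightarrow> \<mu> z' \<le> \<mu> z)"
    by (rule Lattices_Big.ex_has_greatest_nat)
  then obtain z where z: "state z" "\<And>z'. state z' \<Longrightarrow> \<mu> z' \<le> \<mu> z"
    by blast
  obtain S p where Sp: "z = (S, p)" by (cases z)
  have st: "S \<subseteq> V" "set p \<subseteq> V" "S \<inter> set p = {}" "distinct p" "successively R p" "card S \<le> h"
    "\<And>s t. s \<in> S \<Longrightarrow> t \<in> V - S - set p \<Longrightarrow> \<not> R s t"
    using z(1) by (auto simp: state_def Sp)
  have max: "\<not> state (S', p')" if "2 * card S + length p < 2 * card S' + length p'" for S' p'
    using z(2)[of "(S', p')"] that by (auto simp: \<mu>_def Sp)
  have finS: "finite S" using st(1) fin finite_subset by blast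
  have lp: "length p < n" by (rule no_path[OF st(4,2,5)])
  have cardS: "card S = h"
  proof (rule ccontr)
    assume "card S \<noteq> h"
    then have less: "card S < h" using st(6) by simp
    show False
    \<comment> \<open>While \<open>card S < h\<close>, one of three moves is available: start a path
      at an unvisited vertex, extend \<open>p\<close> at its head, or retire the head into
      \<open>S\<close> if it has no unvisited neighbour. Each contradicts maximality.\<close>
    proof (cases p)
      case Nil
      have "card S < card V" using less size lp by simp
      then obtain t where t: "t \<in> V" "t \<notin> S"
        using st(1) by (metis card_mono finS leD subsetI)
      have "state (S, [t])" using st t Nil by (auto simp: state_def)
      then show False using max[of S "[t]"] Nil by simp
    next
      case (Cons x q)
      show False
      proof (cases "\<exists>t \<in> V - S - set p. R x t")
        case True
        then obtain t where t: "t \<in> V - S - set p" "R x t" by blast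
        have "state (S, t # p)" using st t Cons sym by (auto simp: state_def)
        then show False using max[of S "t # p"] by simp
      next
        case False
        have "x \<notin> S" using st(3) Cons by auto
        then have c: "card (insert x S) = Suc (card S)" using finS by simp
        have "state (insert x S, q)" using st False Cons less c
          by (auto simp: state_def successively_Cons)
        then show False using max[of "insert x S" q] c Cons by simp
      qed
    qed
  qed
  have "card (S \<union> set p) = card S + length p"
    using st(3,4) finS by (simp add: card_Un_disjoint distinct_card)
  moreover have "V - S - set p = V - (S \<union> set p)" by blast
  ultimately have "card (V - S - set p) = card V - card S - length p"
    using st(1,2) finS card_Diff_subset[of "S \<union> set p" V] by simp
  \<comment> \<open>Since \<open>p\<close> has at most \<open>n - 1\<close> vertices,
    \<open>size\<close> leaves at least \<open>h\<close> unvisited ones, and any \<open>h\<close> of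
    them serve as \<open>T\<close>.\<close>
  then have "h \<le> card (V - S - set p)" using cardS size lp by simp
  then obtain T where T: "T \<subseteq> V - S - set p" "card T = h"
    by (meson obtain_subset_with_card_n)
  show thesis by (rule that[of S T]) (use st T cardS in auto)
qed

text \<open>All neighbours of the first vertex of a longest path lie on that path. By the degree
  condition one of them is not the second vertex, and the edge to it closes a cycle.\<close>

lemma long_path_imp_cycle:
  fixes E :: "'a set set"
  assumes "finite W" "W \<noteq> {}" "\<And>e. e \<in> E \<Longrightarrow> e \<subseteq> W \<and> card e = 2"
    and deg: "\<And>w. w \<in> W \<Longrightarrow> 2 \<le> card {e \<in> E. w \<in> e}"
  obtains k f where "3 \<le> k" "k \<le> card W" "inj_on f {..<k}" "f ` {..<k} \<subseteq> W"
    "\<And>i. i < k \<Longrightarrow> {f i, f (Suc i mod k)} \<in> E"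
proof -
  define path where "path = (\<lambda>p. distinct p \<and> p \<noteq> [] \<and> set p \<subseteq> W \<and> successively (\<lambda>x y. {x, y} \<in> E) p)"
  obtain w0 where "w0 \<in> W" using assms by blast
  then have "path [w0]" by (simp add: path_def)
  moreover have len: "\<forall>p. path p \<longrightarrow> length p < Suc (card W)"
    using card_mono[OF assms(1)] distinct_card unfolding path_def less_Suc_eq_le by metis
  ultimately have "\<exists>p. path p \<and> (\<forall>q. path q \<longrightarrow> length q \<le> length p)"
    by (rule Lattices_Big.ex_has_greatest_nat)
  then obtain p where p: "path p" "\<And>q. path q \<Longrightarrow> length q \<le> length p"
    by blast
  obtain x q where xq: "p = x # q" using p(1) by (cases p) (auto simp: path_def)
  have xW: "x \<in> W" using p(1) xq by (simp add: path_def)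
  have nb: "y \<in> set q" if "{x, y} \<in> E" for y
  proof (rule ccontr)
    assume "y \<notin> set q"
    moreover have "y \<noteq> x" "y \<in> W" using assms(3)[OF that] by auto
    ultimately have "path (y # p)" using p(1) that by (auto simp: path_def xq insert_commute)
    then show False using p(2)[of "y # p"] by simp
  qed
  \<comment> \<open>If \<open>q\<close> is empty, \<open>hd q\<close> is unspecified, which is
    harmless: the degree bound still gives such a \<open>y\<close>, and \<open>nb\<close> then rules
    this case out.\<close>
  have "\<exists>y. {x, y} \<in> E \<and> y \<noteq> hd q"
  proof (rule ccontr)
    assume a: "\<not> ?thesis"
    have "{e \<in> E. x \<in> e} \<subseteq> {{x, hd q}}"
    proof
      fix e assume e: "e \<in> {e \<in> E. x \<in> e}"
      then obtain y where "e = {x, y}" using assms(3)[of e] by (auto simp: card_2_iff)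
      then show "e \<in> {{x, hd q}}" using a e by auto
    qed
    then have "card {e \<in> E. x \<in> e} \<le> 1"
      using card_mono[of "{{x, hd q}}" "{e \<in> E. x \<in> e}"] by simp
    then show False using deg[OF xW] by simp
  qed
  then obtain y where y: "{x, y} \<in> E" "y \<noteq> hd q" by blast
  then obtain j where j: "j < length q" "q ! j = y" using nb by (meson in_set_conv_nth)
  have "j \<noteq> 0" using j y by (cases q; cases j) auto
  \<comment> \<open>The cycle consists of \<open>x\<close> and the first \<open>j + 1\<close>
    entries of \<open>q\<close>.\<close>
  define k where "k = j + 2"
  have kp: "k \<le> length p" using j by (simp add: k_def xq)
  have dp: "distinct p" using p(1) by (simp add: path_def)
  show thesis
  proof (rule that[of k "\<lambda>i. p ! i"])
    show "3 \<le> k" using \<open>j \<noteq> 0\<close> by (simp add: k_def)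
    show "k \<le> card W" using kp len p(1) by fastforce
    show "inj_on ((!) p) {..<k}" using dp kp by (auto simp: inj_on_def nth_eq_iff_index_eq)
    show "(!) p ` {..<k} \<subseteq> W" using p(1) kp by (auto simp: path_def subset_iff)
    show "{p ! i, p ! (Suc i mod k)} \<in> E" if "i < k" for i
    proof (cases "Suc i = k")
      case True
      then have "p ! i = y" using j by (simp add: k_def xq)
      then show ?thesis using y True by (simp add: xq insert_commute)
    next
      case False
      then have "Suc i < k" using that by simp
      then show ?thesis using p(1) kp
        by (simp add: path_def successively_conv_nth)
    qed
  qed
qed

text \<open>Deleting a vertex of degree at most one costs one vertex and at most one edge, so the
  inequality between vertices and edges survives. Once no such vertex is left,
  \<open>long_path_imp_cycle\<close> applies.\<close>

lemma many_edges_imp_cycle: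
  fixes E :: "'a set set"
  assumes "finite W" "W \<noteq> {}" "\<And>e. e \<in> E \<Longrightarrow> e \<subseteq> W \<and> card e = 2" "card W \<le> card E"
  obtains k f where "3 \<le> k" "k \<le> card W" "inj_on f {..<k}" "f ` {..<k} \<subseteq> W"
    "\<And>i. i < k \<Longrightarrow> {f i, f (Suc i mod k)} \<in> E"
  using assms
proof (induction "card W" arbitrary: W E thesis rule: less_induct)
  case less
  show thesis
  proof (cases "\<forall>w\<in>W. 2 \<le> card {e \<in> E. w \<in> e}")
    case True
    show thesis
      by (rule long_path_imp_cycle[OF less.prems(2,3,4), of E]) (use True less.prems(1) in auto)
  next
    case False
    then obtain w where w: "w \<in> W" "card {e \<in> E. w \<in> e} \<le> 1" by force
    define E' where "E' = E - {e \<in> E. w \<in> e}"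
    have finE: "finite E"
      by (rule finite_subset[of _ "Pow W"]) (use less.prems(2,4) in auto)
    have cE: "card E' = card E - card {e \<in> E. w \<in> e}"
      unfolding E'_def by (rule card_Diff_subset) (use finE in auto)
    have cW: "card (W - {w}) = card W - 1" using w(1) by simp
    have "card W > 0" using less.prems(2,3) by (simp add: card_gt_0_iff)
    have ne: "W - {w} \<noteq> {}"
    proof
      assume "W - {w} = {}"
      then have W: "W = {w}" using w by auto
      have "e \<notin> E" for e
        using less.prems(4)[of e] card_mono[of "{w}" e] unfolding W by auto
      then have "E = {}" by blast
      then show False using less.prems(5) W by simp
    qed
    have sub: "e \<subseteq> W - {w} \<and> card e = 2" if "e \<in> E'" for e
      using that less.prems(4)[of e] by (auto simp: E'_def)
    show thesis
    proof (rule less.hyps[of "W - {w}" E'])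
      show "card (W - {w}) < card W" using cW \<open>card W > 0\<close> by simp
      show "card (W - {w}) \<le> card E'" using cW cE w(2) less.prems(5) by simp
      fix k and f :: "nat \<Rightarrow> 'a"
      assume *: "3 \<le> k" "k \<le> card (W - {w})" "inj_on f {..<k}" "f ` {..<k} \<subseteq> W - {w}"
        "\<And>i. i < k \<Longrightarrow> {f i, f (Suc i mod k)} \<in> E'"
      show thesis
        by (rule less.prems(1)[of k f]) (use * cW E'_def in auto)
    qed (use less.prems(2) ne sub in auto)
  qed
qed

text \<open>The search is applied to the blue graph, so every edge between \<open>S\<close> and
  \<open>T\<close> is red. A cycle among these edges has at most
  \<open>card (S \<union> T) \<le> n\<close> vertices, hence would be a forbidden red cycle.\<close>

lemma not_arrows_imp_sparse_pair:
  fixes G :: "'a graph"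
  assumes G: "simple_graph G" and card: "card (verts G) = 2 * n" and n: "2 \<le> n"
    and bad: "\<not> arrows G (cycles_upto n) (path_graph n)"
  obtains S T where "S \<subseteq> verts G" "T \<subseteq> verts G" "S \<inter> T = {}" "card S = n div 2" "card T = n div 2"
    "card {e \<in> edges G. e \<inter> S \<noteq> {} \<and> e \<inter> T \<noteq> {}} \<le> 2 * (n div 2)"
proof -
  have fin: "finite (verts G)" and E: "\<And>e. e \<in> edges G \<Longrightarrow> e \<subseteq> verts G \<and> card e = 2"
    using G by (auto simp: simple_graph_def)
  obtain c where nored: "\<And>F. F \<in> cycles_upto n \<Longrightarrow> \<not> contains_copy (colour_class G c Red) F"
    and noblue: "\<not> contains_copy (colour_class G c Blue) (path_graph n)"
    using bad by (auto simp: arrows_def)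
  define R where "R = (\<lambda>x y. {x, y} \<in> edges G \<and> c {x, y} = Blue)"
  have len: "length p < n" if p: "distinct p" "set p \<subseteq> verts G" "successively R p" for p
  proof (rule ccontr)
    assume "\<not> length p < n"
    then have le: "n \<le> length p" by simp
    have "R (p ! i) (p ! Suc i)" if "Suc i < n" for i
      using p(3) le that by (simp add: successively_conv_nth)
    moreover have "p ! i \<in> verts G" if "i < n" for i
      using p(2) le that by (simp add: subset_iff)
    moreover have "inj_on ((!) p) {..<n}" using p(1) le
      by (auto simp: inj_on_def nth_eq_iff_index_eq)
    ultimately have "contains_copy (colour_class G c Blue) (path_graph n)"
      unfolding contains_copy_def colour_class_def path_graph_def R_def
      by (intro exI[of _ "(!) p"]) auto
    then show False using noblue by simp
  qed
  obtain S T where ST: "S \<subseteq> verts G" "T \<subseteq> verts G" "S \<inter> T = {}" "card S = n div 2" "card T = n div 2"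
    "\<And>s t. s \<in> S \<Longrightarrow> t \<in> T \<Longrightarrow> \<not> R s t"
    by (rule long_path_or_separated_sets[of "verts G" R n "n div 2"])
       (use fin len card in \<open>auto simp: R_def insert_commute\<close>)
  define X where "X = {e \<in> edges G. e \<inter> S \<noteq> {} \<and> e \<inter> T \<noteq> {}}"
  have X: "\<exists>s\<in>S. \<exists>t\<in>T. e = {s, t}" if "e \<in> X" for e
  proof -
    have "e \<inter> S \<noteq> {}" "e \<inter> T \<noteq> {}" "card e = 2" using that E unfolding X_def by auto
    then obtain s t where st: "s \<in> e" "s \<in> S" "t \<in> e" "t \<in> T" by blast
    moreover have "s \<noteq> t" using st ST(3) by auto
    ultimately have "e = {s, t}" using \<open>card e = 2\<close> by (auto simp: card_2_iff)
    then show ?thesis using st by blast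
  qed
  have red: "c e = Red" if "e \<in> X" for e
  proof -
    have "c e \<noteq> Blue" using X[OF that] ST(6) that unfolding R_def X_def by blast
    then show ?thesis by (cases "c e") auto
  qed
  have finST: "finite S" "finite T"
    using finite_subset[OF ST(1) fin] finite_subset[OF ST(2) fin] by auto
  have cU: "card (S \<union> T) = 2 * (n div 2)"
    using ST finST by (simp add: card_Un_disjoint)
  have "card X < card (S \<union> T)"
  proof (rule ccontr)
    assume "\<not> ?thesis"
    then have le: "card (S \<union> T) \<le> card X" by simp
    have ne: "S \<union> T \<noteq> {}" using cU n by auto
    obtain k f where kf: "3 \<le> k" "k \<le> card (S \<union> T)" "inj_on f {..<k}" "f ` {..<k} \<subseteq> S \<union> T"
      "\<And>i. i < k \<Longrightarrow> {f i, f (Suc i mod k)} \<in> X"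
    proof (rule many_edges_imp_cycle[of "S \<union> T" X])
      show "e \<subseteq> S \<union> T \<and> card e = 2" if "e \<in> X" for e
        using X[OF that] E[of e] that by (auto simp: X_def)
    qed (use finST le ne in auto)
    have "contains_copy (colour_class G c Red) (cycle_graph k)"
      unfolding contains_copy_def colour_class_def cycle_graph_def
      using kf(3,4) ST(1,2) kf(5) red
      by (intro exI[of _ f]) (auto simp: X_def)
    moreover have "cycle_graph k \<in> cycles_upto n"
      using kf(1,2) cU by (auto simp: cycles_upto_def)
    ultimately show False using nored by blast
  qed
  then show thesis using that[of S T] ST cU by (simp add: X_def)
qed

section \<open>A lower bound for the number of regular graphs\<close>

definition vpairs :: "'a set \<Rightarrow> 'a set set" where
  "vpairs V = {e. e \<subseteq> V \<and> card e = 2}"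

definition edeg :: "'a set set \<Rightarrow> 'a \<Rightarrow> nat" where
  "edeg E v = card {e \<in> E. v \<in> e}"

text \<open>With \<open>d\<close> half-edges at each vertex, this is the number of partial pairings
  that project to \<open>E\<close>: each vertex contributes a falling factorial. Truncated
  subtraction makes it vanish as soon as some degree exceeds \<open>d\<close>.\<close>

definition weight :: "nat \<Rightarrow> 'a set \<Rightarrow> 'a set set \<Rightarrow> nat" where
  "weight d V E = (\<Prod>v\<in>V. \<Prod>i<edeg E v. d - i)"

text \<open>The number of partial pairings with \<open>k\<close> pairs that have neither loops nor
  multiple edges.\<close>

definition wsum :: "nat \<Rightarrow> 'a set \<Rightarrow> nat \<Rightarrow> nat" where
  "wsum d V k = (\<Sum>E | E \<subseteq> vpairs V \<and> card E = k. weight d V E)"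

lemma finite_vpairs [simp]: "finite V \<Longrightarrow> finite (vpairs V)"
  by (simp add: vpairs_def)

lemma finite_subset_vpairs: "finite V \<Longrightarrow> E \<subseteq> vpairs V \<Longrightarrow> finite E"
  using finite_vpairs finite_subset by blast

lemma vpairs_cases:
  assumes "e \<in> vpairs V"
  obtains u v where "e = {u, v}" "u \<noteq> v" "u \<in> V" "v \<in> V"
  using assms by (auto simp: vpairs_def card_2_iff)

lemma doubleton_in_vpairs [simp]: "{u, v} \<in> vpairs V \<longleftrightarrow> u \<in> V \<and> v \<in> V \<and> u \<noteq> v"
  by (auto simp: vpairs_def card_insert_if)

lemma edeg_insert:
  assumes "finite E" "e \<notin> E"
  shows "edeg (insert e E) v = edeg E v + of_bool (v \<in> e)"
proof -
  have "{f \<in> insert e E. v \<in> f} = (if v \<in> e then insert e {f \<in> E. v \<in> f} else {f \<in> E. v \<in> f})"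
    by auto
  then show ?thesis using assms by (simp add: edeg_def)
qed

lemma edeg_eq_sum: "finite E \<Longrightarrow> edeg E v = (\<Sum>e\<in>E. of_bool (v \<in> e))"
  by (simp add: edeg_def of_bool_def sum.If_cases Int_def)

lemma sum_edeg:
  assumes "finite V" "E \<subseteq> vpairs V"
  shows "(\<Sum>v\<in>V. edeg E v) = 2 * card E"
proof -
  have fin: "finite E" using assms finite_subset_vpairs by blast
  have "(\<Sum>v\<in>V. edeg E v) = (\<Sum>e\<in>E. \<Sum>v\<in>V. of_bool (v \<in> e))"
    unfolding edeg_eq_sum[OF fin] by (rule sum.swap)
  also have "\<dots> = (\<Sum>e\<in>E. 2)"
  proof (rule sum.cong)
    fix e assume "e \<in> E"
    then have "e \<subseteq> V" "card e = 2" using assms by (auto simp: vpairs_def)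
    then show "(\<Sum>v\<in>V. of_bool (v \<in> e)) = (2::nat)"
      using assms(1) by (simp add: of_bool_def sum.If_cases Int_absorb1)
  qed simp
  finally show ?thesis by simp
qed

lemma weight_pos_iff:
  assumes "finite V"
  shows "weight d V E > 0 \<longleftrightarrow> (\<forall>v\<in>V. edeg E v \<le> d)"
proof -
  have "(\<Prod>i<k. d - i) > 0 \<longleftrightarrow> k \<le> d" for k :: nat
  proof -
    have "(\<Prod>i<k. d - i) > 0 \<longleftrightarrow> (\<forall>i<k. i < d)"
      unfolding neq0_conv[symmetric] by (auto simp: not_le)
    also have "\<dots> \<longleftrightarrow> k \<le> d" by (metis leI le_less_trans less_irrefl less_le_trans)
    finally show ?thesis .
  qed
  then show ?thesis using assms unfolding weight_def neq0_conv[symmetric] by simp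
qed

lemma weight_mono:
  assumes "\<And>v. v \<in> V \<Longrightarrow> edeg E v \<le> edeg E' v" "\<And>v. v \<in> V \<Longrightarrow> edeg E' v \<le> d"
  shows "weight d V E \<le> weight d V E'"
  unfolding weight_def
proof (rule prod_mono, intro conjI)
  fix v assume v: "v \<in> V"
  show "(\<Prod>i<edeg E v. d - i) \<le> (\<Prod>i<edeg E' v. d - i)"
  proof (rule dvd_imp_le)
    show "(\<Prod>i<edeg E v. d - i) dvd (\<Prod>i<edeg E' v. d - i)"
      using assms(1)[OF v] by (intro prod_dvd_prod_subset) auto
    show "0 < (\<Prod>i<edeg E' v. d - i)"
      using assms(2)[OF v] by (intro prod_pos) auto
  qed
qed simp

text \<open>The new edge takes one of the free half-edges at each of its ends.\<close>

lemma weight_insert: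
  assumes "finite V" "finite E" "e \<notin> E" "e \<subseteq> V"
  shows "weight d V (insert e E) = weight d V E * (\<Prod>v\<in>e. d - edeg E v)"
proof -
  have "weight d V (insert e E) =
      (\<Prod>v\<in>V. (\<Prod>i<edeg E v. d - i) * (if v \<in> e then d - edeg E v else 1))"
    unfolding weight_def by (rule prod.cong) (use assms in \<open>auto simp: edeg_insert\<close>)
  also have "\<dots> = weight d V E * (\<Prod>v\<in>V. if v \<in> e then d - edeg E v else 1)"
    by (simp add: prod.distrib weight_def)
  also have "(\<Prod>v\<in>V. if v \<in> e then d - edeg E v else 1) = (\<Prod>v\<in>e. d - edeg E v)"
    using assms by (simp add: prod.If_cases Int_absorb1)
  finally show ?thesis .
qed

text \<open>Double counting of edge sets of size \<open>Suc k\<close> with one marked edge, which is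
  split off.\<close>

lemma wsum_Suc:
  assumes "finite V"
  shows "Suc k * wsum d V (Suc k) =
    (\<Sum>E | E \<subseteq> vpairs V \<and> card E = k. \<Sum>e\<in>vpairs V - E. weight d V (insert e E))"
proof -
  have fin: "finite {E. E \<subseteq> vpairs V \<and> card E = k}" for k
    using assms by simp
  have "Suc k * wsum d V (Suc k) = (\<Sum>E | E \<subseteq> vpairs V \<and> card E = Suc k. \<Sum>e\<in>E. weight d V E)"
    unfolding wsum_def sum_distrib_left by (rule sum.cong) auto
  also have "\<dots> = (\<Sum>(E, e) \<in> Sigma {E. E \<subseteq> vpairs V \<and> card E = Suc k} (\<lambda>E. E). weight d V E)"
    by (rule sum.Sigma) (use fin assms finite_subset_vpairs in auto)
  also have "\<dots> = (\<Sum>(E, e) \<in> Sigma {E. E \<subseteq> vpairs V \<and> card E = k} (\<lambda>E. vpairs V - E).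
      weight d V (insert e E))"
    by (rule sum.reindex_bij_witness[of _ "\<lambda>(E, e). (insert e E, e)" "\<lambda>(E, e). (E - {e}, e)"])
       (use assms finite_subset_vpairs in \<open>auto simp: insert_absorb\<close>)
  also have "\<dots> = (\<Sum>E | E \<subseteq> vpairs V \<and> card E = k. \<Sum>e\<in>vpairs V - E. weight d V (insert e E))"
    by (rule sum.Sigma[symmetric]) (use fin assms in auto)
  finally show ?thesis .
qed

lemma sum_doubletons:
  fixes g :: "'a set \<Rightarrow> nat"
  assumes "finite V" "X \<subseteq> vpairs V"
  shows "(\<Sum>(u, v) | u \<in> V \<and> v \<in> V \<and> {u, v} \<in> X. g {u, v}) = 2 * (\<Sum>e\<in>X. g e)"
proof -
  let ?O = "{(u, v). u \<in> V \<and> v \<in> V \<and> {u, v} \<in> X}"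
  have finO: "finite ?O" by (rule finite_subset[of _ "V \<times> V"]) (use assms in auto)
  have finX: "finite X" using assms finite_subset_vpairs by blast
  have "(\<Sum>(u, v) \<in> ?O. g {u, v}) =
      (\<Sum>e\<in>X. \<Sum>p \<in> {p \<in> ?O. (\<lambda>(u, v). {u, v}) p = e}. (\<lambda>(u, v). g {u, v}) p)"
    by (rule sum.group[symmetric]) (use finO finX in auto)
  also have "\<dots> = (\<Sum>e\<in>X. 2 * g e)"
  proof (rule sum.cong)
    fix e assume e: "e \<in> X"
    then obtain u v where uv: "e = {u, v}" "u \<noteq> v" "u \<in> V" "v \<in> V"
      using assms(2) by (meson subsetD vpairs_cases)
    have "{p \<in> ?O. (\<lambda>(u, v). {u, v}) p = e} = {(u, v), (v, u)}"
      using uv e by (auto simp: doubleton_eq_iff insert_commute)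
    then show "(\<Sum>p \<in> {p \<in> ?O. (\<lambda>(u, v). {u, v}) p = e}. (\<lambda>(u, v). g {u, v}) p) = 2 * g e"
      using uv by (simp add: insert_commute)
  qed simp
  finally show ?thesis by (simp add: sum_distrib_left)
qed

section \<open>Adding edges greedily\<close>

lemma card_neighbours:
  assumes "finite V" "E \<subseteq> vpairs V" 
  shows "card {v \<in> V. {u, v} \<in> E} \<le> edeg E u"
proof -
  have "inj_on (\<lambda>v. {u, v}) {v \<in> V. {u, v} \<in> E}"
    by (auto simp: inj_on_def doubleton_eq_iff)
  moreover have "finite E" using assms finite_subset_vpairs by blast
  ultimately show ?thesis unfolding edeg_def
    by (intro card_inj_on_le[of "\<lambda>v. {u, v}"]) auto
qed

text \<open>Here \<open>f\<close> stands for the number of free half-edges. The square counts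
  ordered pairs of them; these span a new edge (\<open>?A\<close>), lie at a single vertex
  (\<open>?B\<close>), or repeat an edge of \<open>E\<close> (\<open>?C\<close>). The last two kinds
  are only linear in the total.\<close>

lemma greedy_extensions:
  fixes f :: "'a \<Rightarrow> nat"
  assumes V: "finite V" "E \<subseteq> vpairs V" and f: "\<And>v. v \<in> V \<Longrightarrow> f v \<le> d"
    and deg: "\<And>v. v \<in> V \<Longrightarrow> edeg E v \<le> d"
  shows "(\<Sum>v\<in>V. f v)\<^sup>2 \<le> 2 * (\<Sum>e\<in>vpairs V - E. \<Prod>v\<in>e. f v) + (d + d * d) * (\<Sum>v\<in>V. f v)"
proof -
  let ?A = "{(u, v). u \<in> V \<and> v \<in> V \<and> {u, v} \<in> vpairs V - E}"
  let ?B = "Sigma V (\<lambda>u. {u})" and ?C = "Sigma V (\<lambda>u. {v \<in> V. {u, v} \<in> E})"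
  let ?g = "\<lambda>(u, v). f u * f v"
  have fin: "finite ?A" "finite ?B" "finite ?C"
    by (rule finite_subset[of _ "V \<times> V"], use V in auto)+
  have A: "(\<Sum>p\<in>?A. ?g p) = 2 * (\<Sum>e\<in>vpairs V - E. \<Prod>v\<in>e. f v)"
  proof -
    have "(\<Sum>p\<in>?A. ?g p) = (\<Sum>(u, v)\<in>?A. \<Prod>v\<in>{u, v}. f v)"
      by (rule sum.cong) auto
    then show ?thesis using sum_doubletons[of V "vpairs V - E" "\<lambda>e. \<Prod>v\<in>e. f v"] V by auto
  qed
  have B: "(\<Sum>p\<in>?B. ?g p) \<le> d * (\<Sum>v\<in>V. f v)"
  proof -
    have "(\<Sum>p\<in>?B. ?g p) = (\<Sum>u\<in>V. f u * f u)"
      using V(1) by (subst sum.Sigma[symmetric]) auto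
    also have "\<dots> \<le> (\<Sum>u\<in>V. d * f u)" using f by (intro sum_mono) simp
    finally show ?thesis by (simp add: sum_distrib_left)
  qed
  have C: "(\<Sum>p\<in>?C. ?g p) \<le> d * d * (\<Sum>v\<in>V. f v)"
  proof -
    have "(\<Sum>p\<in>?C. ?g p) = (\<Sum>u\<in>V. \<Sum>v | v \<in> V \<and> {u, v} \<in> E. f u * f v)"
      using V(1) by (subst sum.Sigma[symmetric]) auto
    also have "\<dots> \<le> (\<Sum>u\<in>V. d * d * f u)"
    proof (rule sum_mono)
      fix u assume u: "u \<in> V"
      have "(\<Sum>v | v \<in> V \<and> {u, v} \<in> E. f u * f v) \<le> card {v \<in> V. {u, v} \<in> E} * (f u * d)"
        using f by (intro order_trans[OF sum_bounded_above[where K = "f u * d"]]) auto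
      also have "\<dots> \<le> d * (f u * d)"
        using card_neighbours[OF V, of u] deg[OF u] by (intro mult_right_mono) auto
      finally show "(\<Sum>v | v \<in> V \<and> {u, v} \<in> E. f u * f v) \<le> d * d * f u"
        by (simp add: mult_ac)
    qed
    finally show ?thesis by (simp add: sum_distrib_left)
  qed
  have Un: "sum ?g (X \<union> Y) \<le> sum ?g X + sum ?g Y" if "finite X" "finite Y" for X Y
    using sum.union_inter[OF that, of ?g] by linarith
  have "(\<Sum>v\<in>V. f v)\<^sup>2 = (\<Sum>p\<in>V \<times> V. ?g p)"
    by (simp add: power2_eq_square sum_product sum.cartesian_product)
  also have "V \<times> V \<subseteq> ?A \<union> (?B \<union> ?C)" by auto
  then have "(\<Sum>p\<in>V \<times> V. ?g p) \<le> (\<Sum>p\<in>?A \<union> (?B \<union> ?C). ?g p)"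
    using fin by (intro sum_mono2) auto
  also have "\<dots> \<le> (\<Sum>p\<in>?A. ?g p) + ((\<Sum>p\<in>?B. ?g p) + (\<Sum>p\<in>?C. ?g p))"
    using Un[of ?A "?B \<union> ?C"] Un[of ?B ?C] fin by simp
  finally show ?thesis using A B C by (simp add: algebra_simps)
qed

text \<open>\<open>D\<close> is the number of half-edges still free. For an \<open>E\<close> of
  positive weight, \<open>greedy_extensions\<close> with \<open>f v = d - edeg E v\<close> bounds
  the possible next edges; sets of weight zero contribute nothing on the left.\<close>

lemma wsum_greedy:
  assumes V: "finite V" and D: "d * card V = 2 * k + D"
  shows "D\<^sup>2 * wsum d V k \<le> 2 * (Suc k * wsum d V (Suc k)) + (d + d * d) * D * wsum d V k"
proof -
  have "D\<^sup>2 * weight d V E \<le> 2 * (\<Sum>e\<in>vpairs V - E. weight d V (insert e E)) +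
      (d + d * d) * D * weight d V E" if E: "E \<subseteq> vpairs V" "card E = k" for E
  proof (cases "weight d V E = 0")
    case False
    then have deg: "\<And>v. v \<in> V \<Longrightarrow> edeg E v \<le> d" using weight_pos_iff[OF V, of d E] by simp
    have "(\<Sum>v\<in>V. d - edeg E v) + (\<Sum>v\<in>V. edeg E v) = (\<Sum>v\<in>V. d)"
      unfolding sum.distrib[symmetric] by (rule sum.cong) (use deg in auto)
    then have sD: "(\<Sum>v\<in>V. d - edeg E v) = D" using sum_edeg[OF V E(1)] E(2) D by (simp add: mult.commute)
    have "(\<Sum>e\<in>vpairs V - E. weight d V (insert e E)) =
        weight d V E * (\<Sum>e\<in>vpairs V - E. \<Prod>v\<in>e. d - edeg E v)"
      unfolding sum_distrib_left
      by (intro sum.cong refl weight_insert) (use V E finite_subset_vpairs in \<open>auto simp: vpairs_def\<close>)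
    moreover have "D\<^sup>2 \<le> 2 * (\<Sum>e\<in>vpairs V - E. \<Prod>v\<in>e. d - edeg E v) + (d + d * d) * D"
      using greedy_extensions[OF V E(1), of "\<lambda>v. d - edeg E v" d] deg sD by simp
    then have "D\<^sup>2 * weight d V E \<le>
        (2 * (\<Sum>e\<in>vpairs V - E. \<Prod>v\<in>e. d - edeg E v) + (d + d * d) * D) * weight d V E"
      by (rule mult_right_mono) simp
    ultimately show ?thesis by (simp add: algebra_simps)
  qed simp
  then show ?thesis
    unfolding wsum_Suc[OF V] unfolding wsum_def sum_distrib_left sum.distrib[symmetric]
    by (intro sum_mono) auto
qed

section \<open>Completing a nearly regular graph by switchings\<close>

lemma card_edges_meeting:
  assumes "finite B" "finite E"
  shows "card {e \<in> E. e \<inter> B \<noteq> {}} \<le> (\<Sum>b\<in>B. edeg E b)"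
proof -
  have "{e \<in> E. e \<inter> B \<noteq> {}} = (\<Union>b\<in>B. {e \<in> E. b \<in> e})" by auto
  then show ?thesis unfolding edeg_def using card_UN_le[OF assms(1)] by simp
qed

text \<open>Replace an edge \<open>xy\<close> far from \<open>u\<close> and \<open>v\<close> by the edges \<open>ux\<close> and \<open>vy\<close>; here \<open>u = v\<close> is allowed.\<close>

lemma switching_step:
  assumes V: "finite V" "E \<subseteq> vpairs V" and deg: "\<And>v. v \<in> V \<Longrightarrow> edeg E v \<le> d"
    and less: "2 * card E + 2 \<le> d * card V" and many: "2 * (d * (d + 1)) < card E"
  obtains u v x y where "u \<in> V" "v \<in> V" "x \<in> V" "y \<in> V" "{x, y} \<in> E"
    "{u, x} \<notin> E" "{v, y} \<notin> E" "{u, x} \<noteq> {v, y}" "u \<noteq> x" "v \<noteq> y"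
    "\<And>w. w \<in> V \<Longrightarrow> edeg (insert {u, x} (insert {v, y} (E - {{x, y}}))) w = edeg E w + of_bool (w = u) + of_bool (w = v)"
    "\<And>w. w \<in> V \<Longrightarrow> edeg E w + of_bool (w = u) + of_bool (w = v) \<le> d"
proof -
  have finE: "finite E" using V finite_subset_vpairs by blast
  have sum: "(\<Sum>v\<in>V. edeg E v) + 2 \<le> (\<Sum>v\<in>V. d)" using sum_edeg[OF V] less by (simp add: mult.commute)
  obtain u where u: "u \<in> V" "edeg E u < d"
  proof (rule ccontr)
    assume "\<not> thesis"
    then have "(\<Sum>v\<in>V. d) \<le> (\<Sum>v\<in>V. edeg E v)" using that by (intro sum_mono) force
    then show False using sum by simp
  qed
  \<comment> \<open>The total deficit is at least two. Counting \<open>u\<close> as already raised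
    by one still leaves a deficient vertex, which is \<open>u\<close> itself if its own deficit is
    at least two.\<close>
  obtain v where v: "v \<in> V" "edeg E v + of_bool (v = u) < d"
  proof (rule ccontr)
    assume "\<not> thesis"
    then have "(\<Sum>v\<in>V. d) \<le> (\<Sum>v\<in>V. edeg E v + of_bool (v = u))" using that by (intro sum_mono) force
    also have "\<dots> = (\<Sum>v\<in>V. edeg E v) + 1"
      using u V by (simp add: sum.distrib of_bool_def)
    finally show False using sum by simp
  qed
  \<comment> \<open>Closed neighbourhoods. At most \<open>2 * (d + 1) * d\<close> edges meet those
    of \<open>u\<close> and \<open>v\<close>, so \<open>many\<close> yields an edge avoiding both;
    its ends are then adjacent to neither \<open>u\<close> nor \<open>v\<close>.\<close>
  define N where "N = (\<lambda>u. insert u {w \<in> V. {u, w} \<in> E})"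
  have N: "finite (N w)" "card (N w) \<le> d + 1" "N w \<subseteq> V" if "w \<in> V" for w
    using that V(1) card_neighbours[OF V, of w] deg[OF that]
    by (auto simp: N_def card_insert_if)
  have "card {e \<in> E. e \<inter> (N u \<union> N v) \<noteq> {}} \<le> (\<Sum>b\<in>N u \<union> N v. edeg E b)"
    using N(1)[OF u(1)] N(1)[OF v(1)] finE by (intro card_edges_meeting) auto
  also have "\<dots> \<le> card (N u \<union> N v) * d"
  proof -
    have "edeg E b \<le> d" if "b \<in> N u \<union> N v" for b
      using that deg N(3)[OF u(1)] N(3)[OF v(1)] by blast
    then show ?thesis using sum_bounded_above[of "N u \<union> N v" "edeg E" d] by simp
  qed
  also have "\<dots> \<le> (2 * (d + 1)) * d"
    using N[OF u(1)] N[OF v(1)] card_Un_le[of "N u" "N v"] by (intro mult_right_mono) auto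
  also have "\<dots> < card E" using many by (simp add: mult_ac)
  finally have "{e \<in> E. e \<inter> (N u \<union> N v) \<noteq> {}} \<noteq> E" by force
  then obtain e where e: "e \<in> E" "e \<inter> (N u \<union> N v) = {}" by blast
  then obtain x y where xy: "e = {x, y}" "x \<noteq> y" "x \<in> V" "y \<in> V"
    using V(2) by (meson subsetD vpairs_cases)
  have ux: "u \<noteq> x" "{u, x} \<notin> E" "u \<noteq> y" and vy: "v \<noteq> y" "{v, y} \<notin> E" "v \<noteq> x"
    using e xy by (auto simp: N_def)
  have ne: "{u, x} \<noteq> {v, y}" using ux vy xy by (auto simp: doubleton_eq_iff)
  show thesis
  proof (rule that[of u v x y])
    fix w assume w: "w \<in> V"
    define E0 where "E0 = E - {{x, y}}"
    have E: "E = insert {x, y} E0" "{x, y} \<notin> E0" "finite E0" using e xy finE by (auto simp: E0_def)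
    have 1: "edeg E w = edeg E0 w + of_bool (w \<in> {x, y})" unfolding E(1) by (rule edeg_insert[OF E(3,2)])
    have 2: "edeg (insert {v, y} E0) w = edeg E0 w + of_bool (w \<in> {v, y})"
      by (rule edeg_insert) (use E vy in auto)
    have 3: "edeg (insert {u, x} (insert {v, y} E0)) w = edeg (insert {v, y} E0) w + of_bool (w \<in> {u, x})"
      by (rule edeg_insert) (use E ux vy ne in auto)
    show "edeg (insert {u, x} (insert {v, y} (E - {{x, y}}))) w = edeg E w + of_bool (w = u) + of_bool (w = v)"
      using 1 2 3 ux vy xy unfolding E0_def by auto
    show "edeg E w + of_bool (w = u) + of_bool (w = v) \<le> d"
      using u v deg[OF w] by auto
  qed (use u v xy e ux vy ne in auto)
qed

text \<open>A switching keeps the degrees of \<open>x\<close> and \<open>y\<close> and raises those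
  of \<open>u\<close> and \<open>v\<close>, so the weight does not drop. Its result together with
  \<open>(u, v, x, y)\<close> determines the original set, which accounts for the factor
  \<open>card V ^ 4\<close>.\<close>

lemma wsum_switching:
  assumes V: "finite V" and less: "2 * k + 2 \<le> d * card V" and many: "2 * (d * (d + 1)) < k"
  shows "wsum d V k \<le> card V ^ 4 * wsum d V (Suc k)"
proof -
  define \<A> where "\<A> = (\<lambda>k. {E. E \<subseteq> vpairs V \<and> card E = k})"
  \<comment> \<open>Positive weight supplies the degree bound that \<open>switching_step\<close>
    needs; the remaining sets do not contribute to \<open>wsum\<close>.\<close>
  define \<B> where "\<B> = {E \<in> \<A> k. weight d V E > 0}"
  define sw where "sw = (\<lambda>(E :: 'a set set) (u, v, x, y). insert {u, x} (insert {v, y} (E - {{x, y}})))"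
  define ok where "ok = (\<lambda>E (u, v, x, y). u \<in> V \<and> v \<in> V \<and> x \<in> V \<and> y \<in> V \<and> {x, y} \<in> E \<and> {u, x} \<notin> E \<and> {v, y} \<notin> E \<and>
    sw E (u, v, x, y) \<in> \<A> (Suc k) \<and> weight d V E \<le> weight d V (sw E (u, v, x, y)))"
  have fin: "finite (\<A> k)" for k using V by (simp add: \<A>_def)
  have "\<exists>t. ok E t" if E: "E \<in> \<B>" for E
  proof -
    have E': "E \<subseteq> vpairs V" "card E = k" and deg: "\<And>v. v \<in> V \<Longrightarrow> edeg E v \<le> d"
      using E weight_pos_iff[OF V] by (auto simp: \<B>_def \<A>_def)
    have finE: "finite E" using V E' finite_subset_vpairs by blast
    obtain u v x y where s: "u \<in> V" "v \<in> V" "x \<in> V" "y \<in> V" "{x, y} \<in> E"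
      "{u, x} \<notin> E" "{v, y} \<notin> E" "{u, x} \<noteq> {v, y}" "u \<noteq> x" "v \<noteq> y"
      "\<And>w. w \<in> V \<Longrightarrow> edeg (insert {u, x} (insert {v, y} (E - {{x, y}}))) w = edeg E w + of_bool (w = u) + of_bool (w = v)"
      "\<And>w. w \<in> V \<Longrightarrow> edeg E w + of_bool (w = u) + of_bool (w = v) \<le> d"
      by (rule switching_step[OF V E'(1) deg]) (use less many E'(2) in auto)
    have "weight d V E \<le> weight d V (sw E (u, v, x, y))"
      by (rule weight_mono) (use s in \<open>auto simp: sw_def\<close>)
    moreover have "card (sw E (u, v, x, y)) = Suc k"
    proof -
      have "card E \<noteq> 0" using s(5) finE by auto
      then show ?thesis using s finE E'(2) by (simp add: sw_def)
    qed
    ultimately have "ok E (u, v, x, y)" using s E' by (auto simp: ok_def sw_def \<A>_def)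
    then show ?thesis by blast
  qed
  then obtain t where t: "\<And>E. E \<in> \<B> \<Longrightarrow> ok E (t E)" by metis
  have inj: "inj_on (\<lambda>E. (sw E (t E), t E)) \<B>"
  proof (rule inj_onI)
    fix E E' assume a: "E \<in> \<B>" "E' \<in> \<B>" "(sw E (t E), t E) = (sw E' (t E'), t E')"
    obtain u v x y where q: "t E = (u, v, x, y)" by (cases "t E") auto
    have "{x, y} \<in> E" "{x, y} \<in> E'" "{u, x} \<notin> E" "{u, x} \<notin> E'" "{v, y} \<notin> E" "{v, y} \<notin> E'"
      using t[OF a(1)] t[OF a(2)] a(3) q unfolding ok_def by auto
    moreover have "sw E (t E) = sw E' (t E')" "t E = t E'" using a(3) by blast+
    then have "sw E (u, v, x, y) = sw E' (u, v, x, y)" using q by metis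
    \<comment> \<open>Undoing the switching: remove the two new edges and restore the old one. This
      is valid because the new edges were absent from \<open>F\<close> before.\<close>
    moreover have "F = insert a (insert b (insert c (F - {a})) - {b, c})"
      if "a \<in> F" "b \<notin> F" "c \<notin> F" for a b c and F :: "'a set set"
      using that by auto
    then have "F = insert {x, y} (sw F (u, v, x, y) - {{u, x}, {v, y}})"
      if "{x, y} \<in> F" "{u, x} \<notin> F" "{v, y} \<notin> F" for F
      using that unfolding sw_def prod.case .
    ultimately show "E = E'" by metis
  qed
  have "wsum d V k = (\<Sum>E\<in>\<B>. weight d V E)"
    unfolding wsum_def \<A>_def[symmetric]
    by (rule sum.mono_neutral_right) (use fin in \<open>auto simp: \<B>_def \<A>_def\<close>)
  also have "\<dots> \<le> (\<Sum>E\<in>\<B>. weight d V (sw E (t E)))"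
  proof (rule sum_mono)
    fix E assume "E \<in> \<B>"
    then show "weight d V E \<le> weight d V (sw E (t E))"
      using t[of E] by (cases "t E") (auto simp: ok_def)
  qed
  also have "\<dots> = (\<Sum>p \<in> (\<lambda>E. (sw E (t E), t E)) ` \<B>. weight d V (fst p))"
    by (subst sum.reindex[OF inj]) simp
  also have "\<dots> \<le> (\<Sum>p \<in> \<A> (Suc k) \<times> (V \<times> V \<times> V \<times> V). weight d V (fst p))"
  proof (rule sum_mono2)
    show "(\<lambda>E. (sw E (t E), t E)) ` \<B> \<subseteq> \<A> (Suc k) \<times> (V \<times> V \<times> V \<times> V)"
    proof
      fix p assume "p \<in> (\<lambda>E. (sw E (t E), t E)) ` \<B>"
      then obtain E where E: "E \<in> \<B>" "p = (sw E (t E), t E)" by blast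
      show "p \<in> \<A> (Suc k) \<times> (V \<times> V \<times> V \<times> V)"
        using t[OF E(1)] E(2) by (cases "t E") (auto simp: ok_def)
    qed
  qed (use fin V in auto)
  also have "\<dots> = card V ^ 4 * wsum d V (Suc k)"
    unfolding wsum_def
    by (subst sum.cartesian_product[symmetric, of "\<lambda>x y. weight d V x", simplified split_def fst_conv])
       (simp add: card_cartesian_product sum_distrib_left power4_eq_xxxx mult_ac \<A>_def)
  finally show ?thesis .
qed

text \<open>There are \<open>fact (2 * M) / (fact (2 * (M - k)) * 2 ^ k * fact k)\<close> partial
  pairings with \<open>k\<close> pairs in all. The quotient of the two binomial coefficients is the
  accumulated loss from forbidding loops and multiple edges: with \<open>j\<close> pairs still to be
  placed, one greedy step loses at most a factor \<open>(j - c) / j\<close>, and these factors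
  telescope.\<close>

lemma wsum_lower:
  assumes V: "finite V" and M: "d * card V = 2 * M" and c: "d * (d + 1) = 2 * c" and k: "k + c \<le> M"
  shows "fact (2 * M) * ((M - k) choose c) \<le>
    wsum d V k * (M choose c) * fact (2 * (M - k)) * 2 ^ k * fact k"
  using k
proof (induction k)
  case 0
  have "{E. E \<subseteq> vpairs V \<and> card E = 0} = {{}}"
    using finite_subset_vpairs[OF V] by auto
  then have "wsum d V 0 = 1" by (simp add: wsum_def weight_def edeg_def)
  then show ?case by simp
next
  case (Suc k)
  define j where "j = M - k"
  have j: "j > c" "M - Suc k = j - 1" using Suc.prems by (auto simp: j_def)
  let ?B = "M choose c" and ?F = "fact (2 * M) :: nat"
  have IH: "?F * (j choose c) \<le> wsum d V k * ?B * fact (2 * j) * 2 ^ k * fact k"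
    using Suc by (simp add: j_def)
  have "(2 * j)\<^sup>2 * wsum d V k \<le> 2 * (Suc k * wsum d V (Suc k)) + (d + d * d) * (2 * j) * wsum d V k"
    by (rule wsum_greedy[OF V]) (use M Suc.prems in \<open>simp add: j_def\<close>)
  moreover have "d + d * d = 2 * c" using c by (simp add: algebra_simps)
  ultimately have "(2 * j)\<^sup>2 * wsum d V k - 2 * c * (2 * j) * wsum d V k \<le> 2 * (Suc k * wsum d V (Suc k))"
    by simp
  moreover have "(2 * j)\<^sup>2 * wsum d V k - 2 * c * (2 * j) * wsum d V k = 2 * j * (2 * (j - c)) * wsum d V k"
    by (simp add: power2_eq_square diff_mult_distrib diff_mult_distrib2 mult_ac)
  ultimately have G: "2 * j * (2 * (j - c)) * wsum d V k \<le> 2 * (Suc k * wsum d V (Suc k))" by simp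
  have f: "(fact (2 * j) :: nat) = 2 * j * ((2 * j - 1) * fact (2 * (j - 1)))"
  proof -
    obtain i where "j = Suc i" using j(1) by (cases j) auto
    then show ?thesis by simp
  qed
  \<comment> \<open>Both sides of the goal carry the positive factor \<open>2 * j - 1\<close>,
    cancelled at the end. Rounding it up to \<open>2 * j\<close> here makes the absorption identity
    for binomial coefficients applicable.\<close>
  have "(2 * j - 1) * (?F * ((j - 1) choose c)) \<le> 2 * ?F * (j * ((j - 1) choose c))"
    by (simp add: mult_ac)
  also have "\<dots> = 2 * (j - c) * (?F * (j choose c))"
    using binomial_absorb_comp[of j c] by (simp add: mult_ac)
  also have "\<dots> \<le> 2 * (j - c) * (wsum d V k * ?B * fact (2 * j) * 2 ^ k * fact k)"
    by (rule mult_left_mono[OF IH]) simp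
  also have "\<dots> = (2 * j - 1) * ((2 * j * (2 * (j - c)) * wsum d V k) * (?B * fact (2 * (j - 1)) * 2 ^ k * fact k))"
    unfolding f by (simp only: mult_ac)
  also have "\<dots> \<le> (2 * j - 1) * ((2 * (Suc k * wsum d V (Suc k))) * (?B * fact (2 * (j - 1)) * 2 ^ k * fact k))"
    by (intro mult_left_mono mult_right_mono G) simp_all
  also have "\<dots> = (2 * j - 1) * (wsum d V (Suc k) * ?B * fact (2 * (j - 1)) * 2 ^ Suc k * fact (Suc k))"
    by (simp add: algebra_simps)
  finally show ?case using j by simp
qed

text \<open>The greedy bound is used up to \<open>M - c\<close> edges, where
  \<open>c choose c = 1\<close> remains, and the last \<open>c\<close> edges come from switchings.
  By \<open>large\<close> there are always more than \<open>4 * c = 2 * (d * (d + 1))\<close> edges,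
  as switching requires.\<close>

lemma wsum_perfect_lower:
  assumes V: "finite V" and M: "d * card V = 2 * M" and c: "d * (d + 1) = 2 * c" and large: "5 * c < M"
  shows "fact (2 * M) \<le> wsum d V M * card V ^ (4 * c) * (M choose c) * fact (2 * c) * 2 ^ M * fact M"
proof -
  have "wsum d V (M - i) \<le> (card V ^ 4) ^ i * wsum d V M" if "i \<le> c" for i
    using that
  proof (induction i)
    case (Suc i)
    have "wsum d V (M - Suc i) \<le> card V ^ 4 * wsum d V (Suc (M - Suc i))"
      by (rule wsum_switching[OF V]) (use M c Suc.prems large in auto)
    also have "Suc (M - Suc i) = M - i" using Suc.prems large by simp
    also have "card V ^ 4 * wsum d V (M - i) \<le> card V ^ 4 * ((card V ^ 4) ^ i * wsum d V M)"
      using Suc by (intro mult_left_mono) auto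
    finally show ?case by (simp add: mult_ac)
  qed simp
  from this[of c] have W: "wsum d V (M - c) \<le> card V ^ (4 * c) * wsum d V M"
    by (simp add: power_mult)
  have "fact (2 * M) \<le> wsum d V (M - c) * (M choose c) * fact (2 * c) * 2 ^ (M - c) * fact (M - c)"
    using wsum_lower[OF V M c, of "M - c"] large by simp
  also have "\<dots> \<le> (card V ^ (4 * c) * wsum d V M) * (M choose c) * fact (2 * c) * 2 ^ M * fact M"
    by (intro mult_mono W order_refl power_increasing fact_mono) auto
  finally show ?thesis by (simp add: mult_ac)
qed

text \<open>With \<open>M\<close> edges the degrees average \<open>d\<close>, so positive weight
  forces every degree to equal \<open>d\<close>. Each vertex then contributes
  \<open>fact d\<close>.\<close>

lemma wsum_perfect:
  assumes V: "finite V" and M: "d * card V = 2 * M"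
  shows "wsum d V M = fact d ^ card V * card {E. E \<subseteq> vpairs V \<and> (\<forall>v\<in>V. edeg E v = d)}"
proof -
  let ?R = "{E. E \<subseteq> vpairs V \<and> (\<forall>v\<in>V. edeg E v = d)}"
  have sub: "?R \<subseteq> {E. E \<subseteq> vpairs V \<and> card E = M}"
  proof
    fix E assume "E \<in> ?R"
    then show "E \<in> {E. E \<subseteq> vpairs V \<and> card E = M}"
      using sum_edeg[OF V, of E] M by (simp add: mult.commute)
  qed
  have "wsum d V M = (\<Sum>E\<in>?R. weight d V E)"
    unfolding wsum_def
  proof (rule sum.mono_neutral_right)
    show "?R \<subseteq> {E. E \<subseteq> vpairs V \<and> card E = M}" by (rule sub)
    show "\<forall>E \<in> {E. E \<subseteq> vpairs V \<and> card E = M} - ?R. weight d V E = 0"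
    proof
      fix E assume E: "E \<in> {E. E \<subseteq> vpairs V \<and> card E = M} - ?R"
      then obtain v where v: "v \<in> V" "edeg E v \<noteq> d" by auto
      show "weight d V E = 0"
      proof (rule ccontr)
        assume "weight d V E \<noteq> 0"
        then have le: "\<forall>v\<in>V. edeg E v \<le> d" using weight_pos_iff[OF V, of d E] by simp
        then have "(\<Sum>v\<in>V. edeg E v) < (\<Sum>v\<in>V. d)"
          by (intro sum_strict_mono_ex1 V) (use v in force)+
        then show False using E M sum_edeg[OF V, of E] by (simp add: mult.commute)
      qed
    qed
  qed (use V in simp)
  also have "\<dots> = (\<Sum>E\<in>?R. fact d ^ card V)"
  proof (rule sum.cong)
    fix E assume "E \<in> ?R"
    moreover have "(\<Prod>i<d. d - i) = fact d"
      by (simp add: fact_prod_rev lessThan_atLeast0)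
    ultimately show "weight d V E = fact d ^ card V"
      by (simp add: weight_def)
  qed simp
  finally show ?thesis by simp
qed

section \<open>Regular graphs with few edges between two sets\<close>

definition pair_edge :: "'a \<times> 'a \<Rightarrow> 'a set" where
  "pair_edge p = {fst p, snd p}"

definition unpair :: "('a \<times> 'a) list \<Rightarrow> 'a list" where
  "unpair ps = concat (map (\<lambda>p. [fst p, snd p]) ps)"

lemma unpair_simps [simp]: "unpair [] = []" "unpair (p # ps) = fst p # snd p # unpair ps"
  by (simp_all add: unpair_def)

lemma inj_unpair: "unpair ps = unpair qs \<Longrightarrow> ps = qs"
proof (induction ps arbitrary: qs)
  case Nil
  then show ?case by (cases qs) auto
next
  case (Cons p ps)
  then show ?case by (cases qs) (auto simp: prod_eq_iff)
qed

lemma map_unpair: "map f (unpair ps) = unpair (map (map_prod f f) ps)"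
  by (induction ps) auto

lemma card_map_eq:
  assumes "\<And>e. e \<in> set es \<Longrightarrow> card {p. g p = e} = m \<and> finite {p. g p = e}"
  shows "card {ps. map g ps = es} = m ^ length es \<and> finite {ps. map g ps = es}"
  using assms
proof (induction es)
  case (Cons e es)
  have "{ps. map g ps = e # es} = (\<lambda>(p, ps). p # ps) ` ({p. g p = e} \<times> {ps. map g ps = es})"
    by (auto simp: map_eq_Cons_conv)
  moreover have "inj_on (\<lambda>(p, ps). p # ps) ({p. g p = e} \<times> {ps. map g ps = es})"
    by (auto simp: inj_on_def)
  ultimately show ?case using Cons by (simp add: card_image card_cartesian_product)
qed simp

lemma card_ordered_orientations:
  assumes "finite E" "\<And>e. e \<in> E \<Longrightarrow> card e = 2"
  shows "card {ps. map pair_edge ps \<in> permutations_of_set E} = fact (card E) * 2 ^ card E"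
    and "finite {ps. map pair_edge ps \<in> permutations_of_set E}"
proof -
  have fib: "card {p. pair_edge p = e} = 2 \<and> finite {p. pair_edge p = e}" if e: "e \<in> E" for e
  proof -
    obtain u v where "e = {u, v}" "u \<noteq> v" using assms(2)[OF e] by (auto simp: card_2_iff)
    then have "{p. pair_edge p = e} = {(u, v), (v, u)}"
      by (auto simp: pair_edge_def doubleton_eq_iff)
    then show ?thesis using \<open>u \<noteq> v\<close> by simp
  qed
  have 1: "card {ps. map pair_edge ps = es} = 2 ^ card E \<and> finite {ps. map pair_edge ps = es}"
    if "es \<in> permutations_of_set E" for es
    using card_map_eq[of es pair_edge 2] fib that
    by (auto simp: length_finite_permutations_of_set dest: permutations_of_setD)
  have eq: "{ps. map pair_edge ps \<in> permutations_of_set E} =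
      (\<Union>es\<in>permutations_of_set E. {ps. map pair_edge ps = es})" by auto
  show "finite {ps. map pair_edge ps \<in> permutations_of_set E}"
    unfolding eq using 1 assms(1) by auto
  have "card (\<Union>es\<in>permutations_of_set E. {ps. map pair_edge ps = es}) =
      (\<Sum>es\<in>permutations_of_set E. card {ps. map pair_edge ps = es})"
    by (rule card_UN_disjoint) (use 1 assms(1) in auto)
  also have "\<dots> = fact (card E) * 2 ^ card E"
    using 1 assms(1) by simp
  finally show "card {ps. map pair_edge ps \<in> permutations_of_set E} = fact (card E) * 2 ^ card E"
    unfolding eq .
qed

section \<open>Class strings and their exponential weights\<close>

lemma sum_prod_lists:
  fixes g :: "'a \<Rightarrow> 'b :: comm_semiring_1"
  assumes "finite K"
  shows "(\<Sum>xs | set xs \<subseteq> K \<and> length xs = n. \<Prod>x\<leftarrow>xs. g x) = (\<Sum>x\<in>K. g x) ^ n"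
proof (induction n)
  case 0
  have "{xs. set xs \<subseteq> K \<and> length xs = 0} = {[]}" by auto
  then show ?case by simp
next
  case (Suc n)
  let ?L = "{xs. set xs \<subseteq> K \<and> length xs = n}"
  have "{xs. set xs \<subseteq> K \<and> length xs = Suc n} = (\<lambda>(x, xs). x # xs) ` (K \<times> ?L)"
    by (force simp: length_Suc_conv image_iff)
  moreover have "inj_on (\<lambda>(x, xs). x # xs) (K \<times> ?L)" by (auto simp: inj_on_def)
  ultimately have "(\<Sum>xs | set xs \<subseteq> K \<and> length xs = Suc n. \<Prod>x\<leftarrow>xs. g x) =
      (\<Sum>(x, xs) \<in> K \<times> ?L. g x * (\<Prod>x\<leftarrow>xs. g x))"
    by (simp add: sum.reindex split_def)
  also have "\<dots> = (\<Sum>x\<in>K. g x) * (\<Sum>xs\<in>?L. \<Prod>x\<leftarrow>xs. g x)"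
    by (simp add: sum_product sum.cartesian_product)
  finally show ?case using Suc by simp
qed

lemma list_eq_if_filters_eq:
  assumes "map c xs = map c ys" "\<And>a. a \<in> c ` set xs \<Longrightarrow> filter (\<lambda>x. c x = a) xs = filter (\<lambda>x. c x = a) ys"
  shows "xs = ys"
  using assms
proof (induction xs arbitrary: ys)
  case (Cons x xs)
  then obtain y ys' where ys: "ys = y # ys'" "c x = c y" "map c xs = map c ys'" by (cases ys) auto
  have "x = y" using Cons.prems(2)[of "c x"] ys by simp
  moreover have "xs = ys'"
  proof (rule Cons.IH[OF ys(3)])
    fix a assume "a \<in> c ` set xs"
    then have "filter (\<lambda>x. c x = a) (x # xs) = filter (\<lambda>x. c x = a) ys"
      by (intro Cons.prems(2)) auto
    then show "filter (\<lambda>x. c x = a) xs = filter (\<lambda>x. c x = a) ys'"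
      using ys by (auto split: if_splits)
  qed
  ultimately show ?case using ys by simp
qed simp

lemma count_unpair:
  assumes "\<And>p. p \<in> set ps \<Longrightarrow> fst p \<noteq> snd p"
  shows "count (mset (unpair ps)) v = (\<Sum>e\<leftarrow>map pair_edge ps. of_bool (v \<in> e))"
  using assms by (induction ps) (auto simp: pair_edge_def)

lemma prod_list_pairs:
  fixes z :: "'c \<Rightarrow> 'b :: comm_semiring_1"
  shows "(\<Prod>p\<leftarrow>ps. z (fst p) * z (snd p) * (if X p then y else 1)) =
    (\<Prod>x\<leftarrow>unpair ps. z x) * y ^ length (filter X ps)"
  by (induction ps) (simp_all add: mult_ac)

text \<open>A \<open>d\<close>-regular edge set arises from exactly \<open>fact M * 2 ^ M\<close> lists of \<open>M\<close> ordered pairs.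
  Such a list is determined by its string of classes and, for each class, the sequence of the
  vertices of that class; the class strings are counted with exponential weights.\<close>

lemma card_sparse_regular:
  fixes V :: "'a set" and cl :: "'a \<Rightarrow> 'c" and z :: "'c \<Rightarrow> real" and m :: nat
  assumes V: "finite V" and d: "d > 0" and M: "d * card V = 2 * M"
    and K: "finite K" "cl ` V \<subseteq> K" and z: "\<And>c. z c > 0" and y: "0 < y" "y \<le> 1"
    and P: "\<And>u v. u \<in> V \<Longrightarrow> v \<in> V \<Longrightarrow> u \<noteq> v \<Longrightarrow> P {u, v} \<longleftrightarrow> X (cl u, cl v)"
  defines "\<B> \<equiv> {E. E \<subseteq> vpairs V \<and> (\<forall>v\<in>V. edeg E v = d) \<and> card {e \<in> E. P e} \<le> m}"
  shows "real (card \<B>) * (fact M * 2 ^ M) * fact d ^ card V * ((\<Prod>v\<in>V. z (cl v) ^ d) * y ^ m)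
    \<le> (\<Prod>c\<in>K. fact (d * card {v \<in> V. cl v = c})) *
      (\<Sum>p\<in>K \<times> K. z (fst p) * z (snd p) * (if X p then y else 1)) ^ M"
proof -
  define g where "g = (\<lambda>p. z (fst p) * z (snd p) * (if X p then y else 1))"
  \<comment> \<open>\<open>W\<close> is a lower bound for the weight of every class string that
    comes from an edge set in \<open>\<B>\<close>: each vertex occurs \<open>d\<close> times and, as
    \<open>y \<le> 1\<close>, at most \<open>m\<close> crossing pairs cost at most
    \<open>y ^ m\<close>. \<open>\<C>\<close> collects the strings reaching this bound, and
    \<open>D c\<close> holds each vertex of class \<open>c\<close> with multiplicity
    \<open>d\<close>.\<close>
  define W where "W = (\<Prod>v\<in>V. z (cl v) ^ d) * y ^ m"
  define L where "L = {cs. set cs \<subseteq> K \<times> K \<and> length cs = M}"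
  define \<C> where "\<C> = {cs \<in> L. W \<le> (\<Prod>p\<leftarrow>cs. g p)}"
  define D where "D = (\<lambda>c. \<Sum>v | v \<in> V \<and> cl v = c. replicate_mset d v)"
  define \<O> where "\<O> = (\<lambda>E. {ps :: ('a \<times> 'a) list. map pair_edge ps \<in> permutations_of_set E})"
  define n where "n = (\<lambda>c. card {v \<in> V. cl v = c})"
  have g0: "g p > 0" for p using z y by (auto simp: g_def)
  have finL: "finite L" unfolding L_def using K finite_lists_length_eq[of "K \<times> K"] by simp
  have fin\<B>: "finite \<B>" by (rule finite_subset[of _ "Pow (vpairs V)"]) (use V in \<open>auto simp: \<B>_def\<close>)
  have E: "finite E" "card E = M" "\<And>e. e \<in> E \<Longrightarrow> card e = 2" if "E \<in> \<B>" for E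
    using that finite_subset_vpairs[OF V, of E] sum_edeg[OF V, of E] M
    by (auto simp: \<B>_def vpairs_def mult.commute)
  have countD: "count (D c) v = (if v \<in> V \<and> cl v = c then d else 0)" for c v
    using V by (simp add: D_def count_sum sum.delta' if_distrib cong: if_cong)
  have setD: "set_mset (D c) = {v \<in> V. cl v = c}" for c
    using d by (auto simp flip: count_greater_zero_iff simp: countD split: if_splits)

  have list: "(\<Prod>p\<leftarrow>map (map_prod cl cl) ps. g p) \<ge> W" "length ps = M" "set (unpair ps) \<subseteq> V"
    "\<And>c. mset (filter (\<lambda>v. cl v = c) (unpair ps)) = D c"
    if EB: "E \<in> \<B>" and ps: "ps \<in> \<O> E" for E ps
  proof -
    have dist: "distinct (map pair_edge ps)" and set: "pair_edge ` set ps = E"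
      using ps by (auto simp: \<O>_def dest: permutations_of_setD)
    have p: "fst p \<noteq> snd p" "fst p \<in> V" "snd p \<in> V" if "p \<in> set ps" for p
    proof -
      have "pair_edge p \<in> vpairs V" using that set EB by (auto simp: \<B>_def)
      then show "fst p \<noteq> snd p" "fst p \<in> V" "snd p \<in> V" by (simp_all add: pair_edge_def)
    qed
    show len: "length ps = M" using distinct_card[OF dist] set E[OF EB] by simp
    show sub: "set (unpair ps) \<subseteq> V" using p by (auto simp: unpair_def)
    have count: "count (mset (unpair ps)) v = (if v \<in> V then d else 0)" for v
    proof (cases "v \<in> V")
      case True
      have "count (mset (unpair ps)) v = (\<Sum>e\<leftarrow>map pair_edge ps. of_bool (v \<in> e))"
        by (rule count_unpair[OF p(1)])
      also have "\<dots> = (\<Sum>e\<in>E. of_bool (v \<in> e))"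
        using sum_list_distinct_conv_sum_set[OF dist, of "\<lambda>e. of_bool (v \<in> e)"] set by simp
      also have "\<dots> = d" using edeg_eq_sum[OF E(1)[OF EB], of v] EB True by (simp add: \<B>_def)
      finally show ?thesis using True by simp
    qed (use sub in \<open>auto simp: count_eq_zero_iff\<close>)
    show "mset (filter (\<lambda>v. cl v = c) (unpair ps)) = D c" for c
      by (rule multiset_eqI) (simp add: countD count)
    \<comment> \<open>By \<open>P\<close>, whether an edge is counted depends only on the classes of
      its ends, so the count can be read off the class string.\<close>
    have cross: "length (filter X (map (map_prod cl cl) ps)) \<le> m"
    proof -
      have "filter X (map (map_prod cl cl) ps) = map (map_prod cl cl) (filter (P \<circ> pair_edge) ps)"
        using p P by (auto simp: filter_map pair_edge_def intro!: arg_cong[of _ _ "map _"] filter_cong)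
      then have "length (filter X (map (map_prod cl cl) ps)) = length (filter P (map pair_edge ps))"
        by (simp add: filter_map)
      also have "\<dots> = card {e \<in> E. P e}"
        using distinct_length_filter[OF dist, of P] set by (simp add: Int_def conj_commute)
      finally show ?thesis using EB by (simp add: \<B>_def)
    qed
    have "mset (unpair ps) = (\<Sum>v\<in>V. replicate_mset d v)"
      by (rule multiset_eqI)
         (use V in \<open>simp add: count count_sum sum.delta' if_distrib cong: if_cong\<close>)
    moreover have "(\<Prod>x\<leftarrow>unpair ps. z (cl x)) = prod_mset (image_mset (z \<circ> cl) (mset (unpair ps)))"
      by (simp add: prod_mset_prod_list[symmetric] comp_def)
    moreover have "prod_mset (image_mset (z \<circ> cl) (\<Sum>v\<in>A. replicate_mset d v)) = (\<Prod>v\<in>A. z (cl v) ^ d)" if "finite A" for A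
      using that by (induction A) auto
    ultimately have zz: "(\<Prod>x\<leftarrow>unpair ps. z (cl x)) = (\<Prod>v\<in>V. z (cl v) ^ d)" using V by simp
    have "(\<Prod>p\<leftarrow>map (map_prod cl cl) ps. g p) =
        (\<Prod>x\<leftarrow>map cl (unpair ps). z x) * y ^ length (filter X (map (map_prod cl cl) ps))"
      unfolding g_def prod_list_pairs map_unpair ..
    also have "\<dots> = (\<Prod>v\<in>V. z (cl v) ^ d) * y ^ length (filter X (map (map_prod cl cl) ps))"
      using zz by (simp add: comp_def)
    also have "\<dots> \<ge> W" unfolding W_def
      using z y cross by (intro mult_left_mono power_decreasing prod_nonneg) (auto simp: less_imp_le)
    finally show "(\<Prod>p\<leftarrow>map (map_prod cl cl) ps. g p) \<ge> W" .
  qed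

  have cardO: "card (\<Union>E\<in>\<B>. \<O> E) = card \<B> * (fact M * 2 ^ M)"
  proof -
    have "card (\<Union>E\<in>\<B>. \<O> E) = (\<Sum>E\<in>\<B>. card (\<O> E))"
    proof (rule card_UN_disjoint[OF fin\<B>])
      show "\<forall>E\<in>\<B>. finite (\<O> E)"
        unfolding \<O>_def by (intro ballI card_ordered_orientations(2) E(1,3))
      show "\<forall>E\<in>\<B>. \<forall>E'\<in>\<B>. E \<noteq> E' \<longrightarrow> \<O> E \<inter> \<O> E' = {}"
        by (auto simp: \<O>_def dest!: permutations_of_setD(1))
    qed
    also have "\<dots> = (\<Sum>E\<in>\<B>. fact M * 2 ^ M)"
    proof (rule sum.cong)
      fix F assume F: "F \<in> \<B>"
      show "card (\<O> F) = fact M * 2 ^ M"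
        using card_ordered_orientations(1)[OF E(1,3)[OF F]] E(2)[OF F] by (simp add: \<O>_def)
    qed simp
    finally show ?thesis by simp
  qed

  \<comment> \<open>The encoding of an oriented edge list: its class string, and for each class the
    sequence of its vertices, an arrangement of \<open>D c\<close>.\<close>
  define \<Phi> where "\<Phi> = (\<lambda>ps. (map (map_prod cl cl) ps, \<lambda>c\<in>K. filter (\<lambda>v. cl v = c) (unpair ps)))"
  have "card (\<Union>E\<in>\<B>. \<O> E) \<le> card (\<C> \<times> (\<Pi>\<^sub>E c\<in>K. permutations_of_multiset (D c)))"
  proof (rule card_inj_on_le[of \<Phi>])
    show "inj_on \<Phi> (\<Union>E\<in>\<B>. \<O> E)"
    proof (rule inj_onI)
      fix ps qs assume ps: "ps \<in> (\<Union>E\<in>\<B>. \<O> E)" and eq: "\<Phi> ps = \<Phi> qs"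
      have sub: "cl ` set (unpair ps) \<subseteq> K" using ps list(3) K(2) by blast
      have "unpair ps = unpair qs"
      proof (rule list_eq_if_filters_eq[of cl])
        show "map cl (unpair ps) = map cl (unpair qs)" using eq by (simp add: map_unpair \<Phi>_def)
        fix c assume "c \<in> cl ` set (unpair ps)"
        then have "c \<in> K" using sub by blast
        then show "filter (\<lambda>v. cl v = c) (unpair ps) = filter (\<lambda>v. cl v = c) (unpair qs)"
          using eq by (auto simp: \<Phi>_def dest: restrict_cong fun_cong[of _ _ c])
      qed
      then show "ps = qs" by (rule inj_unpair)
    qed
    show "\<Phi> ` (\<Union>E\<in>\<B>. \<O> E) \<subseteq> \<C> \<times> (\<Pi>\<^sub>E c\<in>K. permutations_of_multiset (D c))"
    proof
      fix t assume "t \<in> \<Phi> ` (\<Union>E\<in>\<B>. \<O> E)"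
      then obtain E ps where Eps: "E \<in> \<B>" "ps \<in> \<O> E" "t = \<Phi> ps" by blast
      have "set (map (map_prod cl cl) ps) \<subseteq> K \<times> K"
        using list(3)[OF Eps(1,2)] K(2) by (fastforce simp: unpair_def)
      then show "t \<in> \<C> \<times> (\<Pi>\<^sub>E c\<in>K. permutations_of_multiset (D c))"
        using list[OF Eps(1,2)] unfolding Eps(3) \<Phi>_def \<C>_def L_def
        by (auto intro: permutations_of_multisetI)
    qed
    show "finite (\<C> \<times> (\<Pi>\<^sub>E c\<in>K. permutations_of_multiset (D c)))"
      using finL K by (intro finite_cartesian_product finite_PiE) (auto simp: \<C>_def)
  qed
  then have le: "card \<B> * (fact M * 2 ^ M) \<le> card \<C> * (\<Prod>c\<in>K. card (permutations_of_multiset (D c)))"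
    by (simp add: cardO card_cartesian_product card_PiE K)
  \<comment> \<open>The multinomial count of arrangements; multiplying by
    \<open>fact d ^ n c\<close> avoids a division.\<close>
  have permD: "card (permutations_of_multiset (D c)) * fact d ^ n c = fact (d * n c)" for c
  proof -
    have "size (D c) = d * n c" by (simp add: D_def size_multiset_sum n_def mult.commute)
    moreover have "(\<Prod>x\<in>set_mset (D c). fact (count (D c) x)) = (fact d ^ n c :: nat)"
      by (simp add: setD n_def countD)
    ultimately show ?thesis using card_permutations_of_multiset_aux[of "D c"] by simp
  qed
  have "(\<Sum>c\<in>K. n c) = card V"
  proof -
    have "(\<Sum>c\<in>K. \<Sum>v | v \<in> V \<and> cl v = c. 1) = (\<Sum>v\<in>V. 1 :: nat)"
      by (rule sum.group) (use V K in auto)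
    then show ?thesis by (simp add: n_def)
  qed
  then have "fact d ^ card V = (\<Prod>c\<in>K. fact d ^ n c :: nat)" by (simp add: power_sum[symmetric])
  then have "(card \<B> * (fact M * 2 ^ M)) * fact d ^ card V \<le>
      card \<C> * ((\<Prod>c\<in>K. card (permutations_of_multiset (D c))) * (\<Prod>c\<in>K. fact d ^ n c))"
    using mult_right_mono[OF le, of "fact d ^ card V"] by (simp add: mult_ac)
  also have "\<dots> = card \<C> * (\<Prod>c\<in>K. fact (d * n c))"
    by (simp add: prod.distrib[symmetric] permD)
  finally have "real (card \<B> * (fact M * 2 ^ M) * fact d ^ card V) \<le> real (card \<C> * (\<Prod>c\<in>K. fact (d * n c)))"
    using of_nat_mono by blast
  then have le2: "real (card \<B>) * (fact M * 2 ^ M) * fact d ^ card V \<le> real (card \<C>) * (\<Prod>c\<in>K. fact (d * n c))"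
    by simp
  \<comment> \<open>Markov-type estimate: strings of weight at least \<open>W\<close> are at most
    the total weight of all strings divided by \<open>W\<close>.\<close>
  have "real (card \<C>) * W = (\<Sum>cs\<in>\<C>. W)" by simp
  also have "\<dots> \<le> (\<Sum>cs\<in>\<C>. \<Prod>p\<leftarrow>cs. g p)" by (rule sum_mono) (simp add: \<C>_def)
  also have "\<dots> \<le> (\<Sum>cs\<in>L. \<Prod>p\<leftarrow>cs. g p)"
  proof (rule sum_mono2)
    show "0 \<le> (\<Prod>p\<leftarrow>cs. g p)" for cs
      using g0 by (induction cs) (auto intro: less_imp_le mult_nonneg_nonneg)
  qed (use finL in \<open>auto simp: \<C>_def\<close>)
  also have "\<dots> = (\<Sum>p\<in>K \<times> K. g p) ^ M"
    unfolding L_def using K by (intro sum_prod_lists) simp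
  finally have CW: "real (card \<C>) * W \<le> (\<Sum>p\<in>K \<times> K. g p) ^ M" .
  have W0: "W \<ge> 0" unfolding W_def using z y by (intro mult_nonneg_nonneg prod_nonneg) (auto simp: less_imp_le)
  have "real (card \<B>) * (fact M * 2 ^ M) * fact d ^ card V * W \<le> real (card \<C>) * (\<Prod>c\<in>K. fact (d * n c)) * W"
    by (rule mult_right_mono[OF le2 W0])
  also have "\<dots> = (\<Prod>c\<in>K. fact (d * n c)) * (real (card \<C>) * W)" by (simp only: mult_ac)
  also have "\<dots> \<le> (\<Prod>c\<in>K. fact (d * n c)) * (\<Sum>p\<in>K \<times> K. g p) ^ M"
    by (rule mult_left_mono[OF CW]) (simp add: prod_nonneg)
  finally show ?thesis unfolding W_def g_def n_def .
qed

text \<open>Divided by \<open>fact x * fact y\<close>, this compares two products of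
  \<open>i\<close> factors term by term. It handles the additional half-edges that appear when
  \<open>n\<close> is odd.\<close>

lemma fact_ratio_antimono:
  assumes "x \<le> y"
  shows "fact (x + i) * fact y \<le> (fact x * fact (y + i) :: nat)"
proof (induction i)
  case (Suc i)
  have "fact (x + Suc i) * fact y = Suc (x + i) * (fact (x + i) * fact y :: nat)"
    by (simp add: algebra_simps)
  also have "\<dots> \<le> Suc (y + i) * (fact x * fact (y + i))"
    by (rule mult_mono[OF _ Suc]) (use assms in auto)
  finally show ?case by (simp add: algebra_simps)
qed simp

text \<open>The multinomial coefficient with parts \<open>k\<close>, \<open>k\<close>,
  \<open>2 * k\<close> is a product of two central binomial coefficients, at least
  \<open>4 ^ k / (2 * k)\<close> and \<open>4 ^ (2 * k) / (4 * k)\<close>.\<close>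

lemma multinomial_4k_lower:
  assumes "k > 0"
  shows "64 ^ k * ((fact k)\<^sup>2 * fact (2 * k)) \<le> 8 * (real k)\<^sup>2 * fact (4 * k)"
proof -
  have 1: "4 ^ k / (2 * real k) \<le> ((2 * k) choose k)"
    by (rule central_binomial_lower_bound[OF assms])
  have "2 * (2 * k) = 4 * k" by simp
  then have 2: "4 ^ (2 * k) / (2 * real (2 * k)) \<le> ((4 * k) choose (2 * k))"
    using central_binomial_lower_bound[of "2 * k"] assms by (metis mult_pos_pos zero_less_numeral)
  have "64 ^ k = (4 ^ k * 4 ^ (2 * k) :: real)" by (simp add: power_mult power_mult_distrib[symmetric])
  then have "64 ^ k = 8 * (real k)\<^sup>2 * ((4 ^ k / (2 * real k)) * (4 ^ (2 * k) / (2 * real (2 * k))))"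
    using assms by (simp add: field_simps power2_eq_square)
  also have "\<dots> \<le> 8 * (real k)\<^sup>2 * (real ((2 * k) choose k) * real ((4 * k) choose (2 * k)))"
    by (intro mult_left_mono mult_mono 1 2) auto
  finally have "64 ^ k * ((fact k)\<^sup>2 * fact (2 * k)) \<le>
      8 * (real k)\<^sup>2 * (real ((2 * k) choose k) * real ((4 * k) choose (2 * k))) * ((fact k)\<^sup>2 * fact (2 * k))"
    by (rule mult_right_mono) simp
  also have "\<dots> = 8 * (real k)\<^sup>2 * (((fact k)\<^sup>2 * fact (2 * k)) * real (((2 * k) choose k) * ((4 * k) choose (2 * k))))"
    by (simp only: mult_ac of_nat_mult)
  also have "((fact k)\<^sup>2 * fact (2 * k)) * real (((2 * k) choose k) * ((4 * k) choose (2 * k))) = fact (4 * k)"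
  proof -
    have 3: "fact k * fact k * ((2 * k) choose k) = fact (2 * k)"
      using binomial_fact_lemma[of k "2 * k"] by (simp add: mult_2)
    have 4: "fact (2 * k) * fact (2 * k) * ((4 * k) choose (2 * k)) = fact (4 * k)"
      using binomial_fact_lemma[of "2 * k" "4 * k"] by simp
    have "(fact k)\<^sup>2 * fact (2 * k) * (((2 * k) choose k) * ((4 * k) choose (2 * k))) =
        fact k * fact k * ((2 * k) choose k) * fact (2 * k) * ((4 * k) choose (2 * k))"
      by (simp only: power2_eq_square mult_ac)
    also have "\<dots> = fact (4 * k)" unfolding 3 4 ..
    finally have "(fact k)\<^sup>2 * fact (2 * k) * (((2 * k) choose k) * ((4 * k) choose (2 * k))) = fact (4 * k)" .
    then have "real ((fact k)\<^sup>2 * fact (2 * k) * (((2 * k) choose k) * ((4 * k) choose (2 * k)))) = real (fact (4 * k))"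
      by (rule arg_cong)
    then show ?thesis by simp
  qed
  finally show ?thesis .
qed

text \<open>The upper bound of \<open>card_sparse_regular\<close> is compared with the lower bound
  for all regular graphs. The factors \<open>fact M * 2 ^ M\<close> and
  \<open>fact d ^ (2 * n)\<close> cancel, and what remains of the factorials is a multinomial
  coefficient of about \<open>64 ^ (d * h)\<close>.\<close>

lemma sparse_pair_ratio:
  fixes a y :: real
  assumes d: "d > 0" and c: "d * (d + 1) = 2 * c" and large: "5 * c < d * n" and n: "2 \<le> n"
    and a: "a > 0" and y: "0 < y" "y \<le> 1"
    and ST: "S \<subseteq> {..<2 * n}" "T \<subseteq> {..<2 * n}" "S \<inter> T = {}" "card S = n div 2" "card T = n div 2"
  defines "R \<equiv> {E. E \<subseteq> vpairs {..<2 * n} \<and> (\<forall>v\<in>{..<2 * n}. edeg E v = d)}"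
  defines "h \<equiv> n div 2"
  shows "real (card {E \<in> R. card {e \<in> E. e \<inter> S \<noteq> {} \<and> e \<inter> T \<noteq> {}} \<le> 2 * h}) * 64 ^ (d * h) * (a ^ (2 * d * h) * y ^ (2 * h))
    \<le> real (card R) * (real (2 * n) ^ (4 * c) * real (d * n) ^ c * fact (2 * c) * (8 * (real (d * h))\<^sup>2)) * (2 * a\<^sup>2 * (1 + y) + 4 * a + 1) ^ (d * n)"
proof -
  define V where "V = {..<2 * n}"
  define M where "M = d * n"
  define P where "P = (\<lambda>e. e \<inter> S \<noteq> {} \<and> e \<inter> T \<noteq> {})"
  define B where "B = {E \<in> R. card {e \<in> E. P e} \<le> 2 * h}"
  \<comment> \<open>Classes 0, 1, 2 are \<open>S\<close>, \<open>T\<close> and the rest, with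
    weights \<open>a\<close>, \<open>a\<close>, \<open>1\<close>. Summing over the nine ordered
    pairs of classes, with the pairs (0, 1) and (1, 0) damped by \<open>y\<close>, gives
    \<open>Q\<close>.\<close>
  define cl where "cl = (\<lambda>v. if v \<in> S then 0 else if v \<in> T then 1 else 2 :: nat)"
  define z where "z = (\<lambda>i. if i = (2 :: nat) then 1 else a)"
  define X where "X = (\<lambda>(i :: nat, j). (i = 0 \<and> j = 1) \<or> (i = 1 \<and> j = (0 :: nat)))"
  define G :: real where "G = (fact (d * h))\<^sup>2 * fact (d * (2 * n - 2 * h))"
  define Q where "Q = 2 * a\<^sup>2 * (1 + y) + 4 * a + 1"
  define w where "w = a ^ (2 * d * h) * y ^ (2 * h)"
  have V: "finite V" "card V = 2 * n" "d * card V = 2 * M" by (simp_all add: V_def M_def)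
  have finST: "finite S" "finite T" using ST finite_subset[of _ "{..<2 * n}"] by auto
  have cls: "{v \<in> V. cl v = 0} = S" "{v \<in> V. cl v = 1} = T" "{v \<in> V. cl v = 2} = V - (S \<union> T)"
    using ST by (auto simp: cl_def V_def)
  have cU: "card (S \<union> T) = 2 * h" using ST finST by (simp add: card_Un_disjoint h_def)
  have c2: "card (V - (S \<union> T)) = 2 * n - 2 * h"
    using ST finST V cU by (subst card_Diff_subset) (auto simp: V_def)
  have K: "{0, 1, 2 :: nat} \<times> {0, 1, 2 :: nat} =
      {(0, 0), (0, 1), (0, 2), (1, 0), (1, 1), (1, 2), (2, 0), (2, 1), (2, 2)}" by auto
  have "real (card {E. E \<subseteq> vpairs V \<and> (\<forall>v\<in>V. edeg E v = d) \<and> card {e \<in> E. P e} \<le> 2 * h}) *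
      (fact M * 2 ^ M) * fact d ^ card V * ((\<Prod>v\<in>V. z (cl v) ^ d) * y ^ (2 * h))
    \<le> (\<Prod>c\<in>{0, 1, 2}. fact (d * card {v \<in> V. cl v = c})) *
      (\<Sum>p\<in>{0, 1, 2} \<times> {0, 1, 2}. z (fst p) * z (snd p) * (if X p then y else 1)) ^ M"
  proof (rule card_sparse_regular)
    show "P {u, v} \<longleftrightarrow> X (cl u, cl v)" if "u \<in> V" "v \<in> V" "u \<noteq> v" for u v
      using ST(3) by (auto simp: P_def X_def cl_def)
    show "cl ` V \<subseteq> {0, 1, 2}" by (auto simp: cl_def)
    show "0 < z c" for c using a by (simp add: z_def)
  qed (use V d y in auto)
  moreover have "{E. E \<subseteq> vpairs V \<and> (\<forall>v\<in>V. edeg E v = d) \<and> card {e \<in> E. P e} \<le> 2 * h} = B"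
    by (auto simp: B_def R_def V_def)
  moreover have "(\<Prod>v\<in>V. z (cl v) ^ d) = a ^ (2 * d * h)"
  proof -
    have "(\<Prod>v\<in>V. z (cl v) ^ d) = (\<Prod>v\<in>V. if v \<in> S \<union> T then a ^ d else 1)"
      by (rule prod.cong) (auto simp: z_def cl_def)
    also have "\<dots> = (a ^ d) ^ card (V \<inter> (S \<union> T))"
      using V by (simp add: prod.If_cases Int_def)
    also have "V \<inter> (S \<union> T) = S \<union> T" using ST by (auto simp: V_def)
    finally show ?thesis by (simp add: cU power_mult[symmetric] mult_ac)
  qed
  moreover have "(\<Prod>c\<in>{0, 1, 2}. fact (d * card {v \<in> V. cl v = c})) = G"
    using ST(4,5) c2 by (simp add: cls G_def h_def power2_eq_square del: One_nat_def)
  moreover have "(\<Sum>p\<in>{0, 1, 2} \<times> {0, 1, 2}. z (fst p) * z (snd p) * (if X p then y else 1)) = Q"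
    unfolding K by (simp add: z_def X_def Q_def power2_eq_square algebra_simps)
  ultimately have 1: "real (card B) * (fact M * 2 ^ M) * fact d ^ (2 * n) * w \<le> G * Q ^ M"
    unfolding w_def V(2) by simp
  have "M choose c \<le> M ^ c" by (rule binomial_le_pow) (use large in \<open>simp add: M_def\<close>)
  moreover have "fact (2 * M) \<le> wsum d V M * (2 * n) ^ (4 * c) * (M choose c) * fact (2 * c) * 2 ^ M * fact M"
    using wsum_perfect_lower[OF V(1,3) c] large V(2) by (simp add: M_def)
  ultimately have "fact (2 * M) \<le> wsum d V M * (2 * n) ^ (4 * c) * M ^ c * fact (2 * c) * 2 ^ M * fact M"
    by (meson le_trans mult_le_mono order_refl)
  moreover have "wsum d V M = fact d ^ (2 * n) * card R"
    using wsum_perfect[OF V(1,3)] V(2) by (simp add: R_def V_def)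
  ultimately have "fact (2 * M) \<le> fact d ^ (2 * n) * card R * (2 * n) ^ (4 * c) * M ^ c * fact (2 * c) * 2 ^ M * fact M"
    by simp
  then have "real (fact (2 * M)) \<le> real (fact d ^ (2 * n) * card R * (2 * n) ^ (4 * c) * M ^ c * fact (2 * c) * 2 ^ M * fact M)"
    by (rule of_nat_mono)
  then have 2: "fact (2 * M) \<le> fact d ^ (2 * n) * real (card R) * (real (2 * n) ^ (4 * c) * real M ^ c * fact (2 * c)) * (fact M * 2 ^ M)"
    by (simp add: mult_ac)
  have "64 ^ (d * h) * G \<le> 8 * (real (d * h))\<^sup>2 * fact (2 * M)"
  proof -
    define k where "k = d * h"
    \<comment> \<open>For odd \<open>n\<close>, the two vertices beyond \<open>4 * h\<close> add
      \<open>2 * d\<close> half-edges to the third class.\<close>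
    define i where "i = 2 * d * (n mod 2)"
    have k: "k > 0" using n d by (simp add: k_def h_def div_greater_zero_iff)
    have n2: "n = 2 * h + n mod 2" by (simp add: h_def)
    have e: "d * (2 * n - 2 * h) = 2 * k + i" "2 * M = 4 * k + i"
      unfolding M_def k_def i_def by (subst n2, simp add: algebra_simps)+
    have "real (fact (2 * k + i) * fact (4 * k)) \<le> real (fact (2 * k) * fact (4 * k + i))"
      by (rule of_nat_mono, rule fact_ratio_antimono) simp
    then have A: "fact (2 * k + i) * fact (4 * k) \<le> (fact (2 * k) * fact (4 * k + i) :: real)" by simp
    have "(64 ^ k * (fact k)\<^sup>2) * (fact (2 * k + i) * fact (4 * k)) \<le> (64 ^ k * (fact k)\<^sup>2) * (fact (2 * k) * fact (4 * k + i) :: real)"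
      by (rule mult_left_mono[OF A]) simp
    also have "\<dots> = (64 ^ k * ((fact k)\<^sup>2 * fact (2 * k))) * fact (4 * k + i)" by (simp only: mult_ac)
    also have "\<dots> \<le> (8 * (real k)\<^sup>2 * fact (4 * k)) * fact (4 * k + i)"
      by (rule mult_right_mono[OF multinomial_4k_lower[OF k]]) simp
    finally have "(64 ^ k * ((fact k)\<^sup>2 * fact (2 * k + i))) * fact (4 * k) \<le> (8 * (real k)\<^sup>2 * fact (4 * k + i)) * fact (4 * k)"
      by (simp only: mult_ac)
    then have "64 ^ k * ((fact k)\<^sup>2 * fact (2 * k + i)) \<le> 8 * (real k)\<^sup>2 * fact (4 * k + i)"
      by simp
    then show ?thesis unfolding G_def e k_def[symmetric] .
  qed
  note 3 = this
  define p where "p = real (2 * n) ^ (4 * c) * real M ^ c * fact (2 * c)"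
  define H where "H = (fact (2 * M) :: real)"
  define F where "F = (fact M * 2 ^ M :: real)"
  define f where "f = (fact d ^ (2 * n) :: real)"
  define k8 where "k8 = 8 * (real (d * h))\<^sup>2"
  have nn: "p \<ge> 0" "H > 0" "w \<ge> 0" "Q ^ M \<ge> 0"
    using a y by (simp_all add: p_def H_def w_def Q_def)
  have 1: "real (card B) * F * f * w \<le> G * Q ^ M" using 1 by (simp only: F_def f_def)
  have 2: "H \<le> f * real (card R) * p * F" using 2 by (simp only: H_def f_def p_def F_def)
  have 3: "64 ^ (d * h) * G \<le> k8 * H" using 3 by (simp only: k8_def H_def)
  \<comment> \<open>Facts 2, 1 and 3 are applied in turn to the product with \<open>H\<close>, which
    is cancelled at the end.\<close>
  have "(real (card B) * 64 ^ (d * h) * w) * H \<le> (real (card B) * 64 ^ (d * h) * w) * (f * real (card R) * p * F)"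
    by (rule mult_left_mono[OF 2]) (use nn in simp)
  also have "\<dots> = (real (card B) * F * f * w) * (64 ^ (d * h) * real (card R) * p)" by (simp only: mult_ac)
  also have "\<dots> \<le> (G * Q ^ M) * (64 ^ (d * h) * real (card R) * p)"
    by (rule mult_right_mono[OF 1]) (use nn in simp)
  also have "\<dots> = (64 ^ (d * h) * G) * (real (card R) * p * Q ^ M)" by (simp only: mult_ac)
  also have "\<dots> \<le> (k8 * H) * (real (card R) * p * Q ^ M)"
    by (rule mult_right_mono[OF 3]) (use nn in simp)
  also have "\<dots> = (real (card R) * (p * k8) * Q ^ M) * H" by (simp only: mult_ac)
  finally have "real (card B) * 64 ^ (d * h) * w \<le> real (card R) * (p * k8) * Q ^ M"
    using nn by simp
  then show ?thesis
    unfolding B_def P_def w_def p_def k8_def Q_def M_def by (simp only: mult.assoc)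
qed

section \<open>The failure probability\<close>

lemma edges_regular_graphs:
  "inj_on edges (regular_graphs N d)"
  "edges ` regular_graphs N d = {E. E \<subseteq> vpairs {..<N} \<and> (\<forall>v\<in>{..<N}. edeg E v = d)}"
proof -
  show "inj_on edges (regular_graphs N d)"
    by (auto simp: inj_on_def regular_graphs_def intro: graph.equality)
  show "edges ` regular_graphs N d = {E. E \<subseteq> vpairs {..<N} \<and> (\<forall>v\<in>{..<N}. edeg E v = d)}"
  proof (intro equalityI subsetI)
    fix E assume "E \<in> {E. E \<subseteq> vpairs {..<N} \<and> (\<forall>v\<in>{..<N}. edeg E v = d)}"
    then have "\<lparr>verts = {..<N}, edges = E\<rparr> \<in> regular_graphs N d"
      by (auto simp: regular_graphs_def simple_graph_def regular_def degree_def edeg_def vpairs_def)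
    then show "E \<in> edges ` regular_graphs N d" by force
  qed (auto simp: regular_graphs_def simple_graph_def regular_def degree_def edeg_def vpairs_def)
qed

text \<open>A pair is determined by its union, a subset of \<open>V\<close>, and by \<open>S\<close>
  as one of the \<open>2 ^ (2 * h)\<close> subsets of that union.\<close>

lemma card_disjoint_pairs:
  fixes h :: nat
  assumes "finite V"
  defines "\<P> \<equiv> {(S, T). S \<subseteq> V \<and> T \<subseteq> V \<and> S \<inter> T = {} \<and> card S = h \<and> card T = h}"
  shows "finite \<P>" "card \<P> \<le> 2 ^ (card V + 2 * h)"
proof -
  show "finite \<P>" by (rule finite_subset[of _ "Pow V \<times> Pow V"]) (use assms in auto)
  let ?W = "{W. W \<subseteq> V \<and> card W = 2 * h}"
  have "card \<P> \<le> card (Sigma ?W Pow)"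
  proof (rule card_inj_on_le[of "\<lambda>(S, T). (S \<union> T, S)"])
    show "inj_on (\<lambda>(S, T). (S \<union> T, S)) \<P>" by (auto simp: inj_on_def \<P>_def)
    have "card (S \<union> T) = 2 * h" if "(S, T) \<in> \<P>" for S T
      using that finite_subset[OF _ assms(1), of S] finite_subset[OF _ assms(1), of T]
      by (simp add: \<P>_def card_Un_disjoint)
    then show "(\<lambda>(S, T). (S \<union> T, S)) ` \<P> \<subseteq> Sigma ?W Pow" by (auto simp: \<P>_def)
    show "finite (Sigma ?W Pow)"
      by (rule finite_subset[of _ "Pow V \<times> Pow V"]) (use assms(1) in auto)
  qed
  also have "\<dots> = (\<Sum>W\<in>?W. card (Pow W))"
    by (rule card_SigmaI) (use assms(1) finite_subset in auto)
  also have "\<dots> = (\<Sum>W\<in>?W. 2 ^ (2 * h))"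
  proof (rule sum.cong)
    fix W assume W: "W \<in> ?W"
    then have "finite W" using assms(1) finite_subset by blast
    then show "card (Pow W) = 2 ^ (2 * h)" using W by (simp add: card_Pow)
  qed simp
  also have "\<dots> = card ?W * 2 ^ (2 * h)" by simp
  also have "\<dots> \<le> 2 ^ card V * 2 ^ (2 * h)"
    using card_mono[of "Pow V" ?W] assms(1) by (intro mult_right_mono) (auto simp: card_Pow)
  finally show "card \<P> \<le> 2 ^ (card V + 2 * h)" by (simp add: power_add)
qed

text \<open>The lower bound for \<open>wsum\<close> forces it to be nonzero, because
  \<open>fact (2 * (d * n))\<close> is positive.\<close>

lemma regular_graphs_nonempty:
  assumes "d * (d + 1) = 2 * c" "5 * c < d * n"
  shows "regular_graphs (2 * n) d \<noteq> {}"
proof -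
  have "wsum d {..<2 * n} (d * n) \<noteq> 0"
  proof
    assume "wsum d {..<2 * n} (d * n) = 0"
    then have "fact (2 * (d * n)) \<le> (0 :: nat)"
      using wsum_perfect_lower[of "{..<2 * n}" d "d * n" c] assms by simp
    then show False by simp
  qed
  then have "edges ` regular_graphs (2 * n) d \<noteq> {}"
    using wsum_perfect[of "{..<2 * n}" d "d * n"] unfolding edges_regular_graphs by auto
  then show ?thesis by blast
qed

text \<open>Every graph that fails to arrow has a sparse pair, so \<open>sparse_pair_ratio\<close>
  is summed over all pairs of disjoint \<open>h\<close>-sets.\<close>

lemma failure_count:
  fixes a y :: real
  assumes d: "d > 0" and c: "d * (d + 1) = 2 * c" and large: "5 * c < d * n" and n: "2 \<le> n"
    and a: "a > 0" and y: "0 < y" "y \<le> 1"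
  defines "R \<equiv> regular_graphs (2 * n) d" and "h \<equiv> n div 2"
  shows "real (card {G \<in> R. \<not> arrows G (cycles_upto n) (path_graph n)}) *
      (64 ^ (d * h) * (a ^ (2 * d * h) * y ^ (2 * h)))
    \<le> 2 ^ (2 * n + 2 * h) * (real (card R) * (real (2 * n) ^ (4 * c) * real (d * n) ^ c * fact (2 * c) *
      (8 * (real (d * h))\<^sup>2)) * (2 * a\<^sup>2 * (1 + y) + 4 * a + 1) ^ (d * n))"
    (is "_ * ?w \<le> _ * ?b")
proof -
  define V where "V = {..<2 * n}"
  define \<E> where "\<E> = {E. E \<subseteq> vpairs V \<and> (\<forall>v\<in>V. edeg E v = d)}"
  define \<P> where "\<P> = {(S, T). S \<subseteq> V \<and> T \<subseteq> V \<and> S \<inter> T = {} \<and> card S = h \<and> card T = h}"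
  define B where "B = (\<lambda>(S, T). {E \<in> \<E>. card {e \<in> E. e \<inter> S \<noteq> {} \<and> e \<inter> T \<noteq> {}} \<le> 2 * h})"
  define bad where "bad = {G \<in> R. \<not> arrows G (cycles_upto n) (path_graph n)}"
  have eR: "edges ` R = \<E>" "inj_on edges R"
    using edges_regular_graphs[of "2 * n" d] by (simp_all add: R_def \<E>_def V_def)
  then have cR: "card R = card \<E>" using card_image by metis
  have fin: "finite \<P>" "card \<P> \<le> 2 ^ (2 * n + 2 * h)"
    using card_disjoint_pairs[of V h] by (simp_all add: V_def \<P>_def)
  have fin\<E>: "finite \<E>" using eR(1) finite_regular_graphs by (metis R_def finite_imageI)
  have "card bad = card (edges ` bad)"
    using eR(2) by (intro card_image[symmetric]) (auto simp: bad_def inj_on_def)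
  also have "\<dots> \<le> card (\<Union>p\<in>\<P>. B p)"
  proof (rule card_mono)
    show "finite (\<Union>p\<in>\<P>. B p)" using fin(1) fin\<E> by (auto simp: B_def)
    show "edges ` bad \<subseteq> (\<Union>p\<in>\<P>. B p)"
    proof
      fix E assume "E \<in> edges ` bad"
      then obtain G where G: "E = edges G" "G \<in> R" "\<not> arrows G (cycles_upto n) (path_graph n)"
        by (auto simp: bad_def)
      have G': "simple_graph G" "verts G = V" using G(2) by (auto simp: R_def regular_graphs_def V_def)
      obtain S T where "S \<subseteq> V" "T \<subseteq> V" "S \<inter> T = {}" "card S = h" "card T = h"
        "card {e \<in> edges G. e \<inter> S \<noteq> {} \<and> e \<inter> T \<noteq> {}} \<le> 2 * h"
        by (rule not_arrows_imp_sparse_pair[OF G'(1) _ n G(3)]) (use G' in \<open>auto simp: V_def h_def\<close>)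
      moreover have "E \<in> \<E>" using G(1,2) eR(1) by blast
      ultimately show "E \<in> (\<Union>p\<in>\<P>. B p)" using G(1) by (auto simp: \<P>_def B_def)
    qed
  qed
  also have "\<dots> \<le> (\<Sum>p\<in>\<P>. card (B p))" by (rule card_UN_le[OF fin(1)])
  finally have "real (card bad) \<le> real (\<Sum>p\<in>\<P>. card (B p))" by (rule of_nat_mono)
  moreover have "?w \<ge> 0" using a y by simp
  ultimately have "real (card bad) * ?w \<le> real (\<Sum>p\<in>\<P>. card (B p)) * ?w"
    by (rule mult_right_mono)
  also have "\<dots> = (\<Sum>p\<in>\<P>. real (card (B p)) * ?w)" by (simp add: sum_distrib_right)
  also have "\<dots> \<le> (\<Sum>p\<in>\<P>. ?b)"
  proof (rule sum_mono)
    fix p assume "p \<in> \<P>"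
    then obtain S T where p: "p = (S, T)" "S \<subseteq> V" "T \<subseteq> V" "S \<inter> T = {}" "card S = h" "card T = h"
      by (auto simp: \<P>_def)
    show "real (card (B p)) * ?w \<le> ?b"
      using sparse_pair_ratio[OF d c large n a y, of S T] p
      by (simp add: B_def \<E>_def V_def h_def cR mult.assoc)
  qed
  also have "\<dots> = real (card \<P>) * ?b" by simp
  also have "\<dots> \<le> real (2 ^ (2 * n + 2 * h)) * ?b"
    by (intro mult_right_mono of_nat_mono fin(2)) (use a y in simp)
  finally show ?thesis by (simp add: bad_def)
qed

text \<open>With \<open>\<tau> ^ p = sqrt \<rho>\<close> the expression is at most a constant times
  the \<open>p\<close>-th power of \<open>n * \<tau> ^ n\<close>, which tends to 0. Dividing by
  \<open>sqrt \<rho>\<close> pays for the rounding in \<open>n div 2\<close>.\<close>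

lemma poly_times_half_power_tendsto_0:
  fixes \<rho> :: real
  assumes "0 < \<rho>" "\<rho> < 1" "p > 0"
  shows "(\<lambda>n. real n ^ p * \<rho> ^ (n div 2)) \<longlonglongrightarrow> 0"
proof -
  define \<tau> where "\<tau> = root p (sqrt \<rho>)"
  have \<tau>: "0 < \<tau>" "\<tau> < 1" "\<tau> ^ p = sqrt \<rho>" using assms by (simp_all add: \<tau>_def)
  have "(\<lambda>n. (real n * \<tau> ^ n) ^ p / sqrt \<rho>) \<longlonglongrightarrow> 0 ^ p / sqrt \<rho>"
    by (intro tendsto_intros powser_times_n_limit_0) (use \<tau> assms in auto)
  moreover have "(0 :: real) ^ p / sqrt \<rho> = 0" using assms by simp
  ultimately have lim: "(\<lambda>n. (real n * \<tau> ^ n) ^ p / sqrt \<rho>) \<longlonglongrightarrow> 0" by (simp only:)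
  have "real n ^ p * \<rho> ^ (n div 2) \<le> (real n * \<tau> ^ n) ^ p / sqrt \<rho>" for n
  proof -
    have "\<rho> ^ (n div 2) * sqrt \<rho> = sqrt \<rho> ^ (2 * (n div 2) + 1)"
      using assms by (simp add: power_mult)
    also have "\<dots> \<le> sqrt \<rho> ^ n" using assms by (intro power_decreasing) auto
    also have "\<dots> = (\<tau> ^ n) ^ p" by (simp add: \<tau>(3)[symmetric] power_mult[symmetric] mult.commute)
    finally have "\<rho> ^ (n div 2) \<le> (\<tau> ^ n) ^ p / sqrt \<rho>" using assms by (simp add: field_simps)
    then show ?thesis
      using mult_left_mono[of "\<rho> ^ (n div 2)" "(\<tau> ^ n) ^ p / sqrt \<rho>" "real n ^ p"]
      by (simp add: power_mult_distrib)
  qed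
  then show ?thesis
    by (intro tendsto_sandwich[OF _ _ tendsto_const lim]) (use assms in auto)
qed

text \<open>The weights \<open>2/3\<close> and \<open>1/6\<close> nearly minimise the resulting bound;
  \<open>31\<close> is the least degree for which the minimum is below \<open>1\<close>.\<close>

lemma failure_probability:
  obtains C \<rho> :: real and p :: nat where "0 < \<rho>" "\<rho> < 1" "p > 0"
    "\<forall>\<^sub>F n in sequentially. regular_graphs (2 * n) 31 \<noteq> {} \<and>
       1 - measure_pmf.prob (random_regular_graph (2 * n) 31) {G. arrows G (cycles_upto n) (path_graph n)}
         \<le> C * (real n ^ p * \<rho> ^ (n div 2))"
proof -
  have "\<exists>c. (31 :: nat) * (31 + 1) = 2 * c" by presburger
  \<comment> \<open>The value is 496; it stays symbolic, so that powers and factorials in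
    \<open>c\<close> are not evaluated.\<close>
  then obtain c :: nat where c: "31 * (31 + 1) = 2 * c" by blast
  \<comment> \<open>\<open>Q\<close> is \<open>2 * a\<^sup>2 * (1 + y) + 4 * a + 1\<close> at
    \<open>a = 2 / 3\<close>, \<open>y = 1 / 6\<close>. Below, \<open>\<rho>\<close> is the
    exponential rate per unit of \<open>n div 2\<close>, its leading 64 coming from the number of
    pairs, and \<open>k\<close> gathers the constants of the polynomial factor.\<close>
  define Q :: real where "Q = 127 / 27"
  define \<rho> :: real where "\<rho> = 64 * Q ^ 62 / (64 ^ 31 * ((2 / 3) ^ 62 * (1 / 6) ^ 2))"
  define k where "k = 2 ^ (4 * c) * 31 ^ c * fact (2 * c) * (8 * (31 :: real)\<^sup>2)"
  have \<rho>: "0 < \<rho>" "\<rho> < 1"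
  proof -
    show "0 < \<rho>" by (simp add: \<rho>_def Q_def)
    have "64 * 127 ^ 62 * 3 ^ 62 * 6\<^sup>2 < (64 ^ 31 * 2 ^ 62 * 27 ^ 62 :: real)" by simp
    moreover have "\<rho> = 64 * 127 ^ 62 * 3 ^ 62 * 6\<^sup>2 / (64 ^ 31 * 2 ^ 62 * 27 ^ 62)"
      unfolding \<rho>_def Q_def power_divide
      by (simp del: power_numeral power_Suc add: field_simps)
    moreover have "(0 :: real) < 64 ^ 31 * 2 ^ 62 * 27 ^ 62" by simp
    ultimately show "\<rho> < 1" by (metis divide_less_eq_1_pos)
  qed
  have bound: "1 - measure_pmf.prob (random_regular_graph (2 * n) 31) {G. arrows G (cycles_upto n) (path_graph n)}
       \<le> (4 * Q ^ 31 * k) * (real n ^ (5 * c + 2) * \<rho> ^ (n div 2))"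
    and ne: "regular_graphs (2 * n) 31 \<noteq> {}" if n: "n \<ge> 5 * c + 2" for n
  proof -
    define h where "h = n div 2"
    define R where "R = regular_graphs (2 * n) 31"
    define bad where "bad = {G \<in> R. \<not> arrows G (cycles_upto n) (path_graph n)}"
    have n2: "2 \<le> n" "5 * c < 31 * n" using n by simp_all
    show ne: "regular_graphs (2 * n) 31 \<noteq> {}" by (rule regular_graphs_nonempty[OF c n2(2)])
    have finR: "finite R" by (simp add: R_def finite_regular_graphs)
    then have R0: "real (card R) > 0" using ne by (simp add: R_def card_gt_0_iff)
    have "measure_pmf.prob (random_regular_graph (2 * n) 31) {G. arrows G (cycles_upto n) (path_graph n)} =
        card (R \<inter> {G. arrows G (cycles_upto n) (path_graph n)}) / card R"
      unfolding random_regular_graph_def R_def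
      by (rule measure_pmf_of_set[OF ne finite_regular_graphs])
    also have "R \<inter> {G. arrows G (cycles_upto n) (path_graph n)} = R - bad" by (auto simp: bad_def)
    also have "real (card (R - bad)) = real (card R) - real (card bad)"
      using finR by (subst card_Diff_subset) (auto simp: bad_def intro: of_nat_diff card_mono)
    finally have pr: "1 - measure_pmf.prob (random_regular_graph (2 * n) 31) {G. arrows G (cycles_upto n) (path_graph n)} = card bad / card R"
      using R0 by (simp add: diff_divide_distrib)
    define w :: real where "w = 64 ^ (31 * h) * ((2 / 3) ^ (2 * 31 * h) * (1 / 6) ^ (2 * h))"
    have w0: "w > 0" by (simp add: w_def)
    have Q1: "1 \<le> Q" by (simp add: Q_def)
    have le: "real (card bad) * w \<le> 2 ^ (2 * n + 2 * h) * (real (card R) * (real (2 * n) ^ (4 * c) *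
        real (31 * n) ^ c * fact (2 * c) * (8 * (real (31 * h))\<^sup>2)) * Q ^ (31 * n))"
    proof -
      have "2 * (2 / 3)\<^sup>2 * (1 + 1 / 6) + 4 * (2 / 3) + 1 = Q" by (simp add: Q_def power2_eq_square)
      then show ?thesis
        using failure_count[OF _ c n2(2,1), of "2 / 3" "1 / 6"]
        unfolding w_def h_def R_def bad_def by simp
    qed
    have h: "n \<le> 2 * h + 1" "h \<le> n" by (simp_all add: h_def)
    have "real (2 * n) ^ (4 * c) * real (31 * n) ^ c * fact (2 * c) * (8 * (real (31 * h))\<^sup>2)
        \<le> real (2 * n) ^ (4 * c) * real (31 * n) ^ c * fact (2 * c) * (8 * (real (31 * n))\<^sup>2)"
      using h by (intro mult_left_mono power_mono) auto
    also have "\<dots> = k * real n ^ (5 * c + 2)"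
    proof -
      have "real n ^ (5 * c + 2) = real n ^ (4 * c) * real n ^ c * (real n)\<^sup>2"
        by (simp flip: power_add)
      then show ?thesis unfolding k_def of_nat_mult power_mult_distrib by simp
    qed
    finally have K: "real (2 * n) ^ (4 * c) * real (31 * n) ^ c * fact (2 * c) * (8 * (real (31 * h))\<^sup>2)
      \<le> k * real n ^ (5 * c + 2)" .
    \<comment> \<open>The constants 4 here and \<open>Q ^ 31\<close> below absorb the possible odd
      remainder of \<open>n\<close>.\<close>
    have 2: "(2 :: real) ^ (2 * n + 2 * h) \<le> 4 * 64 ^ h"
    proof -
      have "(2 :: real) ^ (2 * n + 2 * h) \<le> 2 ^ (6 * h + 2)" using h by (intro power_increasing) auto
      then show ?thesis by (simp add: power_add power_mult)
    qed
    have 3: "Q ^ (31 * n) \<le> Q ^ 31 * (Q ^ 62) ^ h"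
    proof -
      have "Q ^ (31 * n) \<le> Q ^ (31 + 62 * h)" using h Q1 by (intro power_increasing) auto
      then show ?thesis by (simp only: power_add power_mult)
    qed
    have wh: "w * \<rho> ^ h = 64 ^ h * (Q ^ 62) ^ h"
    proof -
      have "w = (64 ^ 31 * ((2 / 3) ^ 62 * (1 / 6) ^ 2)) ^ h"
        unfolding w_def power_mult_distrib power_mult[symmetric] by (simp only: mult_numeral_1 arith_simps)
      then have "w * \<rho> ^ h = ((64 ^ 31 * ((2 / 3) ^ 62 * (1 / 6) ^ 2)) * \<rho>) ^ h"
        by (simp only: power_mult_distrib)
      also have "(64 ^ 31 * ((2 / 3) ^ 62 * (1 / 6) ^ 2)) * \<rho> = 64 * Q ^ 62"
        unfolding \<rho>_def by (rule nonzero_mult_div_cancel_left[THEN trans[OF times_divide_eq_right]]) simp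
      finally show ?thesis by (simp only: power_mult_distrib)
    qed
    have "real (card bad) * w \<le> (4 * 64 ^ h) * (real (card R) * (k * real n ^ (5 * c + 2)) * (Q ^ 31 * (Q ^ 62) ^ h))"
    proof (rule order_trans[OF le], rule mult_mono[OF 2 mult_mono[OF mult_left_mono[OF K] 3]])
      have "0 \<le> k" by (simp add: k_def)
      then show "0 \<le> real (card R) * (k * real n ^ (5 * c + 2))" by simp
    qed (use Q1 in simp_all)
    also have "\<dots> = (4 * Q ^ 31 * k) * (real n ^ (5 * c + 2) * (64 ^ h * (Q ^ 62) ^ h)) * real (card R)"
      by (simp only: mult_ac)
    also have "\<dots> = ((4 * Q ^ 31 * k) * (real n ^ (5 * c + 2) * \<rho> ^ h) * real (card R)) * w"
      unfolding wh[symmetric] by (simp only: mult_ac)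
    finally have "real (card bad) \<le> (4 * Q ^ 31 * k) * (real n ^ (5 * c + 2) * \<rho> ^ h) * real (card R)"
      using w0 by (simp only: mult_le_cancel_right_pos)
    then show "1 - measure_pmf.prob (random_regular_graph (2 * n) 31) {G. arrows G (cycles_upto n) (path_graph n)}
       \<le> (4 * Q ^ 31 * k) * (real n ^ (5 * c + 2) * \<rho> ^ (n div 2))"
      unfolding pr h_def[symmetric] using R0 by (simp only: pos_divide_le_eq)
  qed
  show thesis
    by (rule that[OF \<rho>, of "5 * c + 2" "4 * Q ^ 31 * k"])
       (use bound ne in \<open>auto simp: eventually_sequentially\<close>)
qed

section \<open>From the probability to the size-Ramsey number\<close>

lemma size_ramsey_le:
  assumes "simple_graph (G :: nat graph)" "arrows G \<F> H" "card (edges G) \<le> m"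
  shows "size_ramsey \<F> H \<le> enat m"
proof -
  have "size_ramsey \<F> H \<le> enat (card (edges G))"
    unfolding size_ramsey_def by (rule Inf_lower) (use assms in auto)
  also have "\<dots> \<le> enat m" using assms(3) by simp
  finally show ?thesis .
qed

lemma card_edges_regular:
  assumes "G \<in> regular_graphs (2 * n) d"
  shows "card (edges G) = d * n"
proof -
  have E: "edges G \<subseteq> vpairs {..<2 * n}" "\<And>v. v < 2 * n \<Longrightarrow> edeg (edges G) v = d"
    using assms edges_regular_graphs(2)[of "2 * n" d] by blast+
  have "2 * card (edges G) = (\<Sum>v<2 * n. edeg (edges G) v)"
    by (rule sum_edeg[symmetric]) (use E in auto)
  also have "\<dots> = 2 * (d * n)" using E(2) by simp
  finally show ?thesis by simp
qed

theorem theorem3p4: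
  shows "((\<lambda>n. measure_pmf.prob (random_regular_graph (2 * n) 31)
              {G. arrows G (cycles_upto n) (path_graph n)}) \<longlonglongrightarrow> 1) \<and>
         (\<forall>\<^sub>F n in sequentially. size_ramsey (cycles_upto n) (path_graph n) \<le> enat (31 * n))"
proof -
  obtain C \<rho> :: real and p where \<rho>: "0 < \<rho>" "\<rho> < 1" "p > 0" and
    ev: "\<forall>\<^sub>F n in sequentially. regular_graphs (2 * n) 31 \<noteq> {} \<and>
       1 - measure_pmf.prob (random_regular_graph (2 * n) 31) {G. arrows G (cycles_upto n) (path_graph n)}
         \<le> C * (real n ^ p * \<rho> ^ (n div 2))"
    by (rule failure_probability)
  have "(\<lambda>n. 1 - C * (real n ^ p * \<rho> ^ (n div 2))) \<longlonglongrightarrow> 1 - C * 0"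
    by (intro tendsto_intros poly_times_half_power_tendsto_0 \<rho>)
  then have low: "(\<lambda>n. 1 - C * (real n ^ p * \<rho> ^ (n div 2))) \<longlonglongrightarrow> 1" by simp
  have lim: "(\<lambda>n. measure_pmf.prob (random_regular_graph (2 * n) 31)
              {G. arrows G (cycles_upto n) (path_graph n)}) \<longlonglongrightarrow> 1"
  proof (rule tendsto_sandwich[OF _ _ low tendsto_const])
    show "\<forall>\<^sub>F n in sequentially. 1 - C * (real n ^ p * \<rho> ^ (n div 2)) \<le>
        measure_pmf.prob (random_regular_graph (2 * n) 31) {G. arrows G (cycles_upto n) (path_graph n)}"
      using ev by eventually_elim linarith
  qed simp
  \<comment> \<open>Positive probability suffices for the second claim: some graph in the support
    arrows, and it has exactly \<open>31 * n\<close> edges.\<close>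
  have "\<forall>\<^sub>F n in sequentially. 0 < measure_pmf.prob (random_regular_graph (2 * n) 31)
              {G. arrows G (cycles_upto n) (path_graph n)}"
    using order_tendstoD(1)[OF lim, of 0] by simp
  with ev have "\<forall>\<^sub>F n in sequentially. size_ramsey (cycles_upto n) (path_graph n) \<le> enat (31 * n)"
  proof eventually_elim
    case (elim n)
    then have ne: "regular_graphs (2 * n) 31 \<noteq> {}" by blast
    have "set_pmf (random_regular_graph (2 * n) 31) \<inter> {G. arrows G (cycles_upto n) (path_graph n)} \<noteq> {}"
      using elim(2) by (metis less_irrefl measure_pmf_zero_iff)
    then obtain G where G: "G \<in> regular_graphs (2 * n) 31" "arrows G (cycles_upto n) (path_graph n)"
      using set_pmf_of_set[OF ne finite_regular_graphs] by (auto simp: random_regular_graph_def)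
    show ?case
      by (rule size_ramsey_le[OF _ G(2)]) (use G(1) card_edges_regular[OF G(1)] in \<open>auto simp: regular_graphs_def\<close>)
  qed
  with lim show ?thesis by blast
qed

end
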